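(* Let $S\in\mathbb{R}^{K\times K}$ be a symmetric matrix with non-negative entries that has support and is in normal form, with block structure indexed by $\{1,\dots,L+2M\}$. For $\eta>0$ let $v(\eta)=(v_i(\eta))_{i=1}^{L+2M}$, $v_i(\eta)\in(0,\infty)^{k_i}$, be the unique entrywise positive solution of $$\frac{1}{v_i}=\eta+\sum_{j=1}^{L+2M}S_{ij}v_j,\qquad i=1,\dots,L+2M$$ (reciprocal taken entrywise). Let $f=(f_i)$, $i\in\{1,\dots,L+2M\}\cup\{0,\infty\}$, be the unique real vector with $f_0=-1$, $f_\infty=1$, $f_i=0$ for $M<i\le M+L$, $f_i\in(-1,1)$ for $i\in\{1,\dots,M\}\cup\{M+L+1,\dots,L+2M\}$, and $$f_i=\frac12\Big(\min_{j:\,i\lhd j}f_j+\max_{j:\,j\lhd i}f_j\Big)\qquad\text{for all } i\in\{1,\dots,M\}\cup\{M+L+1,\dots,L+2M\}.$$ Then for every $i\in\{1,\dots,L+2M\}$, $$v_i(\eta)\sim\eta^{-f_i},\qquad \eta\in(0,1],$$ i.e. there is a constant $C\ge 1$ depending only on $S$ such that every entry $x$ of the vector $v_i(\eta)$ satisfies $C^{-1}\eta^{-f_i}\le x\le C\eta^{-f_i}$ for all $\eta\in(0,1]$.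
   Context: The equation for $v$ is the Dyson equation $-1/m=z+Sm$ at $z=i\eta$ with $m(i\eta)=i\,v(\eta)$; existence and uniqueness of the positive solution is known. Existence and uniqueness of $f$ as described is also established. A non-negative matrix $R\in\mathbb{R}^{K\times K}$ has support if $r_{i\pi(i)}>0$ for all $i$ for some permutation $\pi$. A non-negative matrix $R\in\mathbb{R}^{k\times k}$ is fully indecomposable (FID) if for all nonempty $I,J\subset\{1,\dots,k\}$ with $|I|+|J|\ge k$ the submatrix $(r_{ij})_{i\in I,j\in J}$ is not identically zero. Normal form. Let $L,M\ge0$ be integers with $L+2M\ge1$. For $i\in\{1,\dots,L+2M\}$ define the complement index $\hat i:=i$ if $M<i\le M+L$, and $\hat i:=L+2M+1-i$ otherwise. A symmetric non-negative matrix $S\in\mathbb{R}^{K\times K}$ is in normal form if, for some such $L,M$ and block dimensions $k_1,\dots,k_{L+2M}\ge1$ with $k_{\hat i}=k_i$ and $\sum_ik_i=K$, when $S=(S_{ij})_{i,j=1}^{L+2M}$ is divided into consecutive blocks $S_{ij}\in\mathbb{R}^{k_i\times k_j}$: (a) $S_{i\hat i}$ is FID for every $i$; (b) $S_{ij}=0$ if $i\ne j$ and $M<i,j\le M+L$; (c) $S_{ij}=0$ if $M<i\le M+L<j$, or $M<j\le M+L<i$, or $i,j>M+L$; (d) $S_{ij}=0$ if ($i\le M$, $j>M+L$ or $j\le M$, $i>M+L$) and $i+j>L+2M+1$. Vectors in $\mathbb{C}^K$ are split into blocks accordingly. Relation $\lhd$: for distinct $i,j\in\{1,\dots,L+2M\}$,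 $i\lhd j$ if and only if $S_{i\hat j}$ is not the zero matrix. It is extended to $\{1,\dots,L+2M\}\cup\{0,\infty\}$ by: $0\lhd i$ if there is no $j\in\{1,\dots,L+2M\}$ with $j\lhd i$; $i\lhd\infty$ if there is no $j\in\{1,\dots,L+2M\}$ with $i\lhd j$. Minima and maxima over $j$ run over $\{1,\dots,L+2M\}\cup\{0,\infty\}$. *)

theory Defs
  imports
    "HOL-Analysis.Analysis"
    "HOL-Combinatorics.Permutations"
    "HOL-Library.Extended_Nat"
    "Jordan_Normal_Form.Matrix"
begin

text \<open>
  Row and column indices of matrices count from 0, as in \<^theory>\<open>Jordan_Normal_Form.Matrix\<close>;
  block indices \<open>i \<in> {1..L + 2 * M}\<close> count from 1. A block structure is given by \<open>L\<close>, \<open>M\<close> and the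
  block dimensions \<open>k\<close>, of which only the values on \<open>{1..L + 2 * M}\<close> matter.
\<close>

definition nonneg_mat :: "real mat \<Rightarrow> bool" where
  "nonneg_mat R \<longleftrightarrow> (\<forall>i<dim_row R. \<forall>j<dim_col R. R $$ (i, j) \<ge> 0)"

definition has_support :: "real mat \<Rightarrow> bool" where
  "has_support R \<longleftrightarrow> square_mat R \<and> nonneg_mat R \<and>
     (\<exists>\<pi>. \<pi> permutes {..<dim_row R} \<and> (\<forall>i<dim_row R. R $$ (i, \<pi> i) > 0))"

definition fully_indecomposable :: "real mat \<Rightarrow> bool" where
  "fully_indecomposable R \<longleftrightarrow> square_mat R \<and> nonneg_mat R \<and>
     (\<forall>I J. I \<noteq> {} \<and> I \<subseteq> {..<dim_row R} \<and> J \<noteq> {} \<and> J \<subseteq> {..<dim_row R} \<and>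
            card I + card J \<ge> dim_row R \<longrightarrow>
        (\<exists>i\<in>I. \<exists>j\<in>J. R $$ (i, j) \<noteq> 0))"

definition block_offset :: "(nat \<Rightarrow> nat) \<Rightarrow> nat \<Rightarrow> nat" where
  "block_offset k i = (\<Sum>l=1..<i. k l)"

definition block :: "real mat \<Rightarrow> (nat \<Rightarrow> nat) \<Rightarrow> nat \<Rightarrow> nat \<Rightarrow> real mat" where
  "block S k i j =
     mat (k i) (k j) (\<lambda>(a, b). S $$ (block_offset k i + a, block_offset k j + b))"

definition compl_index :: "nat \<Rightarrow> nat \<Rightarrow> nat \<Rightarrow> nat" where
  "compl_index L M i = (if M < i \<and> i \<le> M + L then i else L + 2 * M + 1 - i)"

definition normal_form :: "real mat \<Rightarrow> nat \<Rightarrow> nat \<Rightarrow> (nat \<Rightarrow> nat) \<Rightarrow> bool" where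
  "normal_form S L M k \<longleftrightarrow>
     square_mat S \<and> transpose_mat S = S \<and> nonneg_mat S \<and>
     L + 2 * M \<ge> 1 \<and>
     (\<forall>i\<in>{1..L + 2 * M}. k i \<ge> 1 \<and> k (compl_index L M i) = k i) \<and>
     (\<Sum>i=1..L + 2 * M. k i) = dim_row S \<and>
     (\<forall>i\<in>{1..L + 2 * M}. fully_indecomposable (block S k i (compl_index L M i))) \<and>
     (\<forall>i\<in>{1..L + 2 * M}. \<forall>j\<in>{1..L + 2 * M}.
        (i \<noteq> j \<and> M < i \<and> i \<le> M + L \<and> M < j \<and> j \<le> M + L
           \<longrightarrow> block S k i j = 0\<^sub>m (k i) (k j)) \<and>
        ((M < i \<and> i \<le> M + L \<and> M + L < j) \<or> (M < j \<and> j \<le> M + L \<and> M + L < i) \<or>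
         (i > M + L \<and> j > M + L)
           \<longrightarrow> block S k i j = 0\<^sub>m (k i) (k j)) \<and>
        (((i \<le> M \<and> j > M + L) \<or> (j \<le> M \<and> i > M + L)) \<and> i + j > L + 2 * M + 1
           \<longrightarrow> block S k i j = 0\<^sub>m (k i) (k j)))"

definition block_rel ::
    "real mat \<Rightarrow> nat \<Rightarrow> nat \<Rightarrow> (nat \<Rightarrow> nat) \<Rightarrow> nat \<Rightarrow> nat \<Rightarrow> bool" where
  "block_rel S L M k i j \<longleftrightarrow>
     i \<in> {1..L + 2 * M} \<and> j \<in> {1..L + 2 * M} \<and> i \<noteq> j \<and>
     block S k i (compl_index L M j) \<noteq> 0\<^sub>m (k i) (k (compl_index L M j))"

text \<open>
  The extended index set \<open>{1..L + 2 * M} \<union> {0, \<infinity>}\<close> is a subset of \<^typ>\<open>enat\<close>. Only the elements of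
  \<^typ>\<open>enat\<close> and their names are used; the relation is unrelated to the order of \<^typ>\<open>enat\<close>.
\<close>

definition ext_indices :: "nat \<Rightarrow> nat \<Rightarrow> enat set" where
  "ext_indices L M = enat ` {1..L + 2 * M} \<union> {0, \<infinity>}"

definition ext_rel ::
    "real mat \<Rightarrow> nat \<Rightarrow> nat \<Rightarrow> (nat \<Rightarrow> nat) \<Rightarrow> enat \<Rightarrow> enat \<Rightarrow> bool" where
  "ext_rel S L M k x y \<longleftrightarrow>
     (\<exists>i j. x = enat i \<and> y = enat j \<and> block_rel S L M k i j) \<or>
     (x = 0 \<and> (\<exists>i\<in>{1..L + 2 * M}. y = enat i \<and>
        \<not> (\<exists>j\<in>{1..L + 2 * M}. block_rel S L M k j i))) \<or>
     (y = \<infinity> \<and> (\<exists>i\<in>{1..L + 2 * M}. x = enat i \<and>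
        \<not> (\<exists>j\<in>{1..L + 2 * M}. block_rel S L M k i j)))"

definition exponent_system ::
    "real mat \<Rightarrow> nat \<Rightarrow> nat \<Rightarrow> (nat \<Rightarrow> nat) \<Rightarrow> (enat \<Rightarrow> real) \<Rightarrow> bool" where
  "exponent_system S L M k f \<longleftrightarrow>
     f 0 = -1 \<and> f \<infinity> = 1 \<and>
     (\<forall>i\<in>{M<..M + L}. f (enat i) = 0) \<and>
     (\<forall>i\<in>{1..M} \<union> {M + L + 1..L + 2 * M}.
        f (enat i) \<in> {-1<..<1} \<and>
        f (enat i) =
          1 / 2 * (Min (f ` {x \<in> ext_indices L M. ext_rel S L M k (enat i) x}) +
                   Max (f ` {x \<in> ext_indices L M. ext_rel S L M k x (enat i)})))"

definition positive_dyson_solution ::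
    "real mat \<Rightarrow> nat \<Rightarrow> nat \<Rightarrow> (nat \<Rightarrow> nat) \<Rightarrow> real \<Rightarrow> (nat \<Rightarrow> real vec) \<Rightarrow> bool" where
  "positive_dyson_solution S L M k \<eta> v \<longleftrightarrow>
     (\<forall>i\<in>{1..L + 2 * M}.
        v i \<in> carrier_vec (k i) \<and> (\<forall>a<k i. v i $ a > 0) \<and>
        (\<forall>a<k i. 1 / v i $ a = \<eta> + (\<Sum>j=1..L + 2 * M. (block S k i j *\<^sub>v v j) $ a)))"

end

(*
Put l = -ln eta. Comparing the critical point w of the Dyson functional (convex in ln w) with the
vector of ones bounds the product of the entries of w from below, while w_a w_b <= 1/s_ab whenever
s_ab > 0. Hence w_a w_b is of order 1 along a permutation in the support of S; triangularity forces
this permutation to map each block onto its complement, and full indecomposability then makes the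
entries within one block comparable. So w is of order exp(x_i) on block i, with x_i + x_(compl i)
bounded. Summing the equation over complementary blocks gives a flow balance at i, whose terms are
of order exp(x_i - x_j) for i <| j and exp(x_j - x_i) for j <| i, with x_0 = -l and
x_infinity = l. Taking logarithms, 2 x_i equals min x_j + max x_j up to a bounded error. The
relation <| is acyclic, so a discrete maximum principle shows that solutions of this min-max system
are stable under bounded errors; f_i l solves it exactly, hence |x_i - f_i l| is bounded.
*)
theory Submission
  imports Defs
begin

section \<open>A discrete maximum principle for averaged systems\<close>

lemma sum_le_card_mult_term:
  fixes g :: "'a \<Rightarrow> real"
  assumes "finite A" "A \<noteq> {}"
  shows "\<exists>a\<in>A. sum g A \<le> real (card A) * g a"
proof -
  have "Max (g ` A) \<in> g ` A"
    using assms by (intro Max_in) auto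
  then obtain a where a: "a \<in> A" "g a = Max (g ` A)" by (metis imageE)
  have "sum g A \<le> of_nat (card A) * g a"
    by (rule sum_bounded_above) (use a assms in auto)
  then show ?thesis using a by metis
qed

text \<open>Let \<open>d\<close> be the largest value, or 0. Each step averages a value at most
  \<open>d\<close> with one of smaller rank, so induction on the rank gives
  \<open>\<delta> j \<le> (1 - 1 / 2 ^ \<rho> j) * d + c\<close>. Where \<open>d\<close> is
  attained, solving for \<open>d\<close> yields \<open>d \<le> 2 ^ n * c\<close>.\<close>

lemma discrete_max_principle:
  fixes \<delta> :: "'a \<Rightarrow> real" and \<rho> :: "'a \<Rightarrow> nat"
  assumes fin: "finite I" and c: "0 \<le> c"
    and rank: "\<And>i. i \<in> I \<Longrightarrow> 1 \<le> \<rho> i \<and> \<rho> i \<le> n"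
    and step: "\<And>i. i \<in> I \<Longrightarrow> \<delta> i \<le> c \<or>
      (\<exists>p q. 2 * \<delta> i \<le> p + q + c \<and> (p \<le> 0 \<or> (\<exists>j\<in>I. p \<le> \<delta> j)) \<and>
             (q \<le> 0 \<or> (\<exists>j\<in>I. \<rho> j < \<rho> i \<and> q \<le> \<delta> j)))"
    and i: "i \<in> I"
  shows "\<delta> i \<le> 2 ^ n * c"
proof -
  \<comment> \<open>Inserting 0 makes \<open>d\<close> nonnegative, so that it also bounds the
    alternative \<open>p \<le> 0\<close>.\<close>
  define d where "d = Max (insert 0 (\<delta> ` I))"
  have d0: "0 \<le> d" and d_ge: "\<And>j. j \<in> I \<Longrightarrow> \<delta> j \<le> d"
    unfolding d_def using fin by (auto intro!: Max_ge)
  have main: "\<delta> j \<le> (1 - 1 / 2 ^ \<rho> j) * d + c" if "j \<in> I" for j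
    using that
  proof (induction "\<rho> j" arbitrary: j rule: less_induct)
    case less
    have r1: "1 \<le> \<rho> j" using rank less.prems by auto
    have nn: "0 \<le> (1 - 1 / 2 ^ \<rho> j) * d" using d0 by simp
    from step[OF less.prems] show ?case
    proof
      assume "\<delta> j \<le> c" then show ?thesis using nn by linarith
    next
      assume "\<exists>p q. 2 * \<delta> j \<le> p + q + c \<and> (p \<le> 0 \<or> (\<exists>j\<in>I. p \<le> \<delta> j)) \<and>
             (q \<le> 0 \<or> (\<exists>j'\<in>I. \<rho> j' < \<rho> j \<and> q \<le> \<delta> j'))"
      then obtain p q where pq: "2 * \<delta> j \<le> p + q + c" "p \<le> 0 \<or> (\<exists>j\<in>I. p \<le> \<delta> j)"
        "q \<le> 0 \<or> (\<exists>j'\<in>I. \<rho> j' < \<rho> j \<and> q \<le> \<delta> j')" by blast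
      have p: "p \<le> d" using pq(2) d0 d_ge by force
      have pw: "(2::real) ^ \<rho> j = 2 * 2 ^ (\<rho> j - 1)"
        using r1 by (metis One_nat_def Suc_pred less_eq_Suc_le power_Suc)
      \<comment> \<open>The factor is \<open>1 - 1 / 2 ^ (\<rho> j - 1)\<close>, the weakest
        induction bound among the smaller ranks.\<close>
      have "q \<le> (1 - 2 / 2 ^ \<rho> j) * d + c"
      proof (cases "q \<le> 0")
        case True
        have "0 \<le> (1 - 2 / 2 ^ \<rho> j) * d"
          using d0 unfolding pw by (intro mult_nonneg_nonneg) (auto simp: field_simps)
        then show ?thesis using True c by linarith
      next
        case False
        then obtain j' where j': "j' \<in> I" "\<rho> j' < \<rho> j" "q \<le> \<delta> j'" using pq(3) by blast
        have "(2::real) ^ \<rho> j' \<le> 2 ^ (\<rho> j - 1)" using j'(2) by (intro power_increasing) auto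
        then have "2 / 2 ^ \<rho> j \<le> 1 / (2::real) ^ \<rho> j'"
          unfolding pw by (simp add: field_simps)
        then have "(1 - 1 / 2 ^ \<rho> j') * d \<le> (1 - 2 / 2 ^ \<rho> j) * d"
          using d0 by (intro mult_right_mono) auto
        then show ?thesis using j' less.hyps[of j'] by fastforce
      qed
      then have "2 * \<delta> j \<le> d + (1 - 2 / 2 ^ \<rho> j) * d + c + c" using pq(1) p by linarith
      moreover have "d + (1 - 2 / 2 ^ \<rho> j) * d + c + c = 2 * ((1 - 1 / 2 ^ \<rho> j) * d + c)"
        by (simp add: algebra_simps)
      ultimately have "2 * \<delta> j \<le> 2 * ((1 - 1 / 2 ^ \<rho> j) * d + c)" by (rule ord_le_eq_trans)
      then show ?thesis by (rule mult_left_le_imp_le) simp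
    qed
  qed
  have "d \<le> 2 ^ n * c"
  proof -
    have "d \<in> insert 0 (\<delta> ` I)" unfolding d_def using fin by (intro Max_in) auto
    then consider "d = 0" | j where "j \<in> I" "d = \<delta> j" by auto
    then show ?thesis
    proof cases
      case 1 then show ?thesis using c by simp
    next
      case 2
      have "(2::real) ^ \<rho> j \<le> 2 ^ n" using rank[OF 2(1)] by (intro power_increasing) auto
      moreover have "d \<le> 2 ^ \<rho> j * c"
        using main[OF 2(1)] unfolding 2(2)[symmetric] by (simp add: field_simps)
      ultimately show ?thesis using c by (meson mult_right_mono order_trans)
    qed
  qed
  then show ?thesis using d_ge[OF i] by linarith
qed

section \<open>The Dyson equation on a triangular block system\<close>

text \<open>This and the next three constants bound errors on the logarithmic scale. They involve
  only \<open>K\<close>, \<open>\<sigma>\<close> and \<open>\<tau>\<close>, hence neither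
  \<open>\<eta>\<close> nor the block structure. Here the parts are twice the bound of
  \<open>sum_X_lower\<close> and one \<open>- ln \<sigma>\<close> per index.\<close>

definition pair_const :: "nat \<Rightarrow> real \<Rightarrow> real \<Rightarrow> real" where
  "pair_const K \<sigma> \<tau> = 2 * (real K * real K * \<tau> + real K) - real K * ln \<sigma>"

definition block_const :: "nat \<Rightarrow> real \<Rightarrow> real \<Rightarrow> real" where
  "block_const K \<sigma> \<tau> = 3 * real K * pair_const K \<sigma> \<tau>"

text \<open>Three block errors come from \<open>cross_value\<close>, \<open>\<sigma>\<close> and
  \<open>\<tau>\<close> from the entries of \<open>s\<close>, and the last logarithm from replacing
  a sum by its dominant term.\<close>

definition flow_const :: "nat \<Rightarrow> real \<Rightarrow> real \<Rightarrow> real" where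
  "flow_const K \<sigma> \<tau> = 3 * block_const K \<sigma> \<tau> - ln \<sigma> + ln \<tau> + ln (2 * real K * real K)"

definition balance_const :: "nat \<Rightarrow> real \<Rightarrow> real \<Rightarrow> real" where
  "balance_const K \<sigma> \<tau> = 2 * flow_const K \<sigma> \<tau> + 2 * block_const K \<sigma> \<tau>"

text \<open>The normal form recast on scalar indices. \<open>triangular\<close> collects the zero
  blocks; \<open>block_connected\<close> keeps from full indecomposability the strong connectivity
  of the graph on a block with an edge from \<open>a\<close> to \<open>a'\<close> whenever
  \<open>s a (\<pi> a')\<close> is positive.\<close>

locale block_system =
  fixes K n :: nat and s :: "nat \<Rightarrow> nat \<Rightarrow> real" and \<sigma> \<tau> :: real
    and \<beta> h \<pi> :: "nat \<Rightarrow> nat"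
  assumes block_range: "a < K \<Longrightarrow> \<beta> a \<in> {1..n}"
    and compl_range: "i \<in> {1..n} \<Longrightarrow> h i \<in> {1..n}"
    and compl_compl: "i \<in> {1..n} \<Longrightarrow> h (h i) = i"
    and block_nonempty: "i \<in> {1..n} \<Longrightarrow> \<exists>a<K. \<beta> a = i"
    and s_sym: "a < K \<Longrightarrow> b < K \<Longrightarrow> s a b = s b a"
    and s_nonneg: "a < K \<Longrightarrow> b < K \<Longrightarrow> 0 \<le> s a b"
    and s_lower: "a < K \<Longrightarrow> b < K \<Longrightarrow> 0 < s a b \<Longrightarrow> \<sigma> \<le> s a b"
    and s_upper: "a < K \<Longrightarrow> b < K \<Longrightarrow> s a b \<le> \<tau>"
    and sigma: "0 < \<sigma>" "\<sigma> \<le> 1"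
    and tau: "1 \<le> \<tau>"
    and triangular: "a < K \<Longrightarrow> b < K \<Longrightarrow> 0 < s a b \<Longrightarrow> \<beta> a \<le> h (\<beta> b)"
    and perm: "\<pi> permutes {..<K}"
    and perm_pos: "a < K \<Longrightarrow> 0 < s a (\<pi> a)"
    and perm_block: "a < K \<Longrightarrow> \<beta> (\<pi> a) = h (\<beta> a)"
    and block_connected: "I \<noteq> {} \<Longrightarrow> I \<subset> {a. a < K \<and> \<beta> a = i} \<Longrightarrow>
          \<exists>a\<in>I. \<exists>a'\<in>{a. a < K \<and> \<beta> a = i} - I. 0 < s a (\<pi> a')"
begin

definition B :: "nat \<Rightarrow> nat set" where "B i = {a. a < K \<and> \<beta> a = i}"

text \<open>As \<open>h\<close> is an involution, \<open>h (\<beta> b) = j\<close> places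
  \<open>b\<close> in the complement of block \<open>j\<close>, as in the relation of the normal
  form.\<close>

definition rel :: "nat \<Rightarrow> nat \<Rightarrow> bool" where
  "rel i j \<longleftrightarrow> i \<noteq> j \<and> (\<exists>a<K. \<exists>b<K. \<beta> a = i \<and> h (\<beta> b) = j \<and> 0 < s a b)"

lemma finite_B [simp]: "finite (B i)"
  unfolding B_def by auto

lemma card_B: "card (B i) \<le> K"
  using card_mono[of "{..<K}" "B i"] unfolding B_def by auto

lemma B_nonempty: "i \<in> {1..n} \<Longrightarrow> B i \<noteq> {}"
  using block_nonempty unfolding B_def by blast

text \<open>Triangularity makes the relation acyclic, so that block indices can serve as ranks in
  \<open>discrete_max_principle\<close>.\<close>

lemma rel_less: "rel i j \<Longrightarrow> i < j"
  using triangular unfolding rel_def by fastforce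

lemma rel_range: "rel i j \<Longrightarrow> i \<in> {1..n} \<and> j \<in> {1..n}"
  unfolding rel_def using block_range compl_range by blast

lemma rel_compl: "rel i j \<Longrightarrow> rel (h j) (h i)"
  unfolding rel_def using s_sym block_range compl_compl by (metis)

lemma perm_less: "a < K \<Longrightarrow> \<pi> a < K"
  using permutes_in_image[OF perm] by auto

lemma perm_inv_ex: "b < K \<Longrightarrow> \<exists>a<K. \<pi> a = b"
  using permutes_image[OF perm] by (metis (no_types, lifting) image_iff lessThan_iff)

lemma perm_B: "i \<in> {1..n} \<Longrightarrow> \<pi> ` B i = B (h i)"
proof (intro subset_antisym subsetI)
  fix b assume i: "i \<in> {1..n}" and b: "b \<in> B (h i)"
  then obtain a where "a < K" "\<pi> a = b" using perm_inv_ex unfolding B_def by blast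
  then show "b \<in> \<pi> ` B i"
    using b i perm_block block_range compl_compl unfolding B_def
    by (metis (mono_tags, lifting) image_eqI mem_Collect_eq)
qed (auto simp: B_def perm_block perm_less)

lemma card_B_compl: "i \<in> {1..n} \<Longrightarrow> card (B (h i)) = card (B i)"
  using perm_B card_image[OF inj_on_subset[OF permutes_inj[OF perm]], of "B i"] by simp

lemma pair_const_nonneg: "0 \<le> pair_const K \<sigma> \<tau>"
proof -
  have "ln \<sigma> \<le> 0" using sigma by simp
  then have "real K * ln \<sigma> \<le> 0" by (simp add: mult_nonneg_nonpos)
  moreover have "0 \<le> real K * real K * \<tau>" using tau by simp
  ultimately show ?thesis unfolding pair_const_def by simp
qed

lemma block_const_nonneg: "0 \<le> block_const K \<sigma> \<tau>"
  unfolding block_const_def using pair_const_nonneg by simp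

end

locale block_dyson = block_system +
  fixes \<eta> :: real and w :: "nat \<Rightarrow> real"
  assumes eta: "0 < \<eta>" "\<eta> \<le> 1"
    and w_pos: "a < K \<Longrightarrow> 0 < w a"
    and dyson: "a < K \<Longrightarrow> w a * (\<eta> + (\<Sum>b<K. s a b * w b)) = 1"
begin

section \<open>Entries of the solution, within one block and across complementary blocks\<close>

definition X :: "nat \<Rightarrow> real" where "X a = ln (w a)"

definition T :: "nat \<Rightarrow> nat \<Rightarrow> real" where "T a b = s a b * w a * w b"

lemma T_nonneg: "a < K \<Longrightarrow> b < K \<Longrightarrow> 0 \<le> T a b"
  unfolding T_def using s_nonneg w_pos by (simp add: less_imp_le)

lemma T_sym: "a < K \<Longrightarrow> b < K \<Longrightarrow> T a b = T b a"
  unfolding T_def using s_sym by (simp add: mult_ac)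

lemma row_sum: "a < K \<Longrightarrow> \<eta> * w a + (\<Sum>b<K. T a b) = 1"
  using dyson[of a] unfolding T_def by (simp add: algebra_simps sum_distrib_left)

lemma ln_T: "a < K \<Longrightarrow> b < K \<Longrightarrow> 0 < s a b \<Longrightarrow> ln (T a b) = ln (s a b) + X a + X b"
  using w_pos[of a] w_pos[of b] unfolding T_def X_def by (simp add: ln_mult_pos)

text \<open>
  In the variables \<open>ln w\<close> the Dyson equation is the critical point equation of the convex function
  \<open>\<Sum>a b. s a b * w a * w b / 2 + \<eta> * (\<Sum>a. w a) - (\<Sum>a. ln w a)\<close>, whose value at the minimizer is
  compared with the value at \<open>w = 1\<close>.
\<close>

lemma sum_X_lower: "- (real K * real K * \<tau> + real K) \<le> (\<Sum>a<K. X a)"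
proof -
  \<comment> \<open>Convexity enters through \<open>t * (1 - ln t) \<le> 1\<close> for positive
    \<open>t\<close>, here with \<open>t = w a * w b\<close> and in the next fact with
    \<open>t = w a\<close>.\<close>
  have 1: "T a b * (1 - X a - X b) \<le> s a b" if "a < K" "b < K" for a b
  proof -
    have p: "0 < w a * w b" using that w_pos by simp
    have "1 - ln (w a * w b) \<le> 1 / (w a * w b)"
      using ln_le_minus_one[of "1 / (w a * w b)"] p by (simp add: ln_divide_pos)
    then have "T a b * (1 - X a - X b) \<le> T a b * (1 / (w a * w b))"
      using T_nonneg[OF that] w_pos that
      by (intro mult_left_mono) (auto simp: X_def ln_mult_pos diff_diff_eq)
    also have "\<dots> = s a b" using w_pos[OF that(1)] w_pos[OF that(2)] unfolding T_def by (simp add: field_simps)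
    finally show ?thesis .
  qed
  have 2: "\<eta> * w a * (1 - X a) \<le> \<eta>" if "a < K" for a
  proof -
    have p: "0 < w a" using that w_pos by simp
    have "1 - X a \<le> 1 / w a"
      using ln_le_minus_one[of "1 / w a"] p by (simp add: ln_divide_pos X_def)
    then have "\<eta> * w a * (1 - X a) \<le> \<eta> * w a * (1 / w a)"
      using p eta by (intro mult_left_mono) auto
    then show ?thesis using p by simp
  qed
  have sw: "(\<Sum>a<K. \<Sum>b<K. T a b * X b) = (\<Sum>a<K. \<Sum>b<K. T a b * X a)"
    by (subst sum.swap) (auto intro!: sum.cong simp: T_sym)
  have "(\<Sum>a<K. \<Sum>b<K. T a b * (1 - X a - X b)) \<le> (\<Sum>a<K. \<Sum>b<K. \<tau>)"
    by (intro sum_mono order_trans[OF 1 s_upper]) auto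
  then have A: "(\<Sum>a<K. \<Sum>b<K. T a b) - 2 * (\<Sum>a<K. \<Sum>b<K. T a b * X a) \<le> real K * real K * \<tau>"
    by (simp add: right_diff_distrib sum_subtractf sw)
  have "(\<Sum>a<K. \<eta> * w a * (1 - X a)) \<le> (\<Sum>a<K. 1)"
    by (intro sum_mono order_trans[OF 2 eta(2)]) auto
  then have Bd: "(\<Sum>a<K. \<eta> * w a) - (\<Sum>a<K. \<eta> * w a * X a) \<le> real K"
    by (simp add: right_diff_distrib sum_subtractf)
  \<comment> \<open>Weighting \<open>X a\<close> by its completed row sum, which is 1, produces the
    two sums bounded from below by \<open>A\<close> and \<open>Bd\<close>.\<close>
  have "(\<Sum>a<K. X a) = (\<Sum>a<K. (\<eta> * w a + (\<Sum>b<K. T a b)) * X a)"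
    by (intro sum.cong) (auto simp: row_sum)
  also have "\<dots> = (\<Sum>a<K. \<eta> * w a * X a) + (\<Sum>a<K. \<Sum>b<K. T a b * X a)"
    by (simp add: distrib_right sum.distrib sum_distrib_right)
  finally have C: "(\<Sum>a<K. X a) = (\<Sum>a<K. \<eta> * w a * X a) + (\<Sum>a<K. \<Sum>b<K. T a b * X a)" .
  have D: "0 \<le> (\<Sum>a<K. \<eta> * w a)" using w_pos eta by (intro sum_nonneg) (simp add: less_imp_le)
  have E: "0 \<le> (\<Sum>a<K. \<Sum>b<K. T a b)" using T_nonneg by (intro sum_nonneg) auto
  have F: "0 \<le> real K * real K * \<tau>" using tau by simp
  show ?thesis using A Bd C D E F by linarith
qed

text \<open>A single \<open>T a b\<close> is at most the row sum 1, and a positive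
  \<open>s a b\<close> is at least \<open>\<sigma>\<close>.\<close>

lemma pos_entry_upper:
  assumes "a < K" "b < K" "0 < s a b"
  shows "X a + X b \<le> - ln \<sigma>"
proof -
  have "0 < T a b" using assms w_pos unfolding T_def by simp
  have "T a b \<le> (\<Sum>b<K. T a b)"
    using assms T_nonneg by (intro member_le_sum) auto
  also have "\<dots> \<le> 1" using row_sum[OF assms(1)] eta w_pos[OF assms(1)]
    by (smt (verit) mult_pos_pos)
  finally have "ln (T a b) \<le> 0" using \<open>0 < T a b\<close> by simp
  moreover have "ln \<sigma> \<le> ln (s a b)" using s_lower[OF assms] sigma by simp
  ultimately show ?thesis using ln_T[OF assms] by linarith
qed

lemma sigma_le_pair_const:
  assumes "a < K" shows "- ln \<sigma> \<le> pair_const K \<sigma> \<tau>"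
proof -
  have "1 * (- ln \<sigma>) \<le> real K * (- ln \<sigma>)" using assms sigma by (intro mult_right_mono) auto
  moreover have "0 \<le> real K * real K * \<tau>" using tau by simp
  ultimately show ?thesis unfolding pair_const_def by simp
qed

text \<open>Over all indices the pair sums \<open>X b + X (\<pi> b)\<close> add up to twice the sum
  of \<open>X\<close>, which \<open>sum_X_lower\<close> bounds from below. As every other pair is at
  most \<open>- ln \<sigma>\<close>, no single pair can be very negative.\<close>

lemma support_pair:
  assumes a: "a < K"
  shows "\<bar>X a + X (\<pi> a)\<bar> \<le> pair_const K \<sigma> \<tau>"
proof -
  have lns: "ln \<sigma> \<le> 0" using sigma by simp
  have up: "X b + X (\<pi> b) \<le> - ln \<sigma>" if "b < K" for b
    using pos_entry_upper[OF that perm_less[OF that] perm_pos[OF that]] .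
  have "(\<Sum>b<K. X (\<pi> b)) = (\<Sum>b<K. X b)"
    using sum.permute[OF perm, of X] by (simp add: o_def)
  then have "(\<Sum>b<K. X b + X (\<pi> b)) = 2 * (\<Sum>b<K. X b)"
    by (simp add: sum.distrib)
  moreover have "(\<Sum>b<K. X b + X (\<pi> b)) = X a + X (\<pi> a) + (\<Sum>b\<in>{..<K} - {a}. X b + X (\<pi> b))"
    using a by (intro sum.remove) auto
  moreover have "(\<Sum>b\<in>{..<K} - {a}. X b + X (\<pi> b)) \<le> (\<Sum>b\<in>{..<K} - {a}. - ln \<sigma>)"
    using up by (intro sum_mono) auto
  moreover have "(\<Sum>b\<in>{..<K} - {a}. - ln \<sigma>) = - (real K * ln \<sigma>) + ln \<sigma>"
    using a by (simp add: algebra_simps of_nat_diff)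
  ultimately have "2 * (\<Sum>b<K. X b) \<le> X a + X (\<pi> a) - real K * ln \<sigma> + ln \<sigma>"
    by linarith
  then have "- pair_const K \<sigma> \<tau> \<le> X a + X (\<pi> a)"
    using sum_X_lower lns unfolding pair_const_def by argo
  then show ?thesis using up[OF a] sigma_le_pair_const[OF a] by linarith
qed

text \<open>A set is grown from \<open>a\<close> by one index at a time. An edge from
  \<open>b\<close> to \<open>b'\<close> bounds \<open>X b + X (\<pi> b')\<close> from above, while
  \<open>support_pair\<close> bounds \<open>X b' + X (\<pi> b')\<close> from below; the difference
  costs twice \<open>pair_const\<close> per step, and fewer than \<open>K\<close> steps fill the
  block.\<close>

lemma block_spread:
  assumes a: "a \<in> B i" and a': "a' \<in> B i"
  shows "X a - X a' \<le> 2 * real K * pair_const K \<sigma> \<tau>"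
proof -
  let ?c = "pair_const K \<sigma> \<tau>"
  have grow: "\<exists>I. I \<subseteq> B i \<and> a \<in> I \<and> card I = Suc m \<and> (\<forall>b\<in>I. X a - X b \<le> 2 * real m * ?c)"
    if "Suc m \<le> card (B i)" for m
    using that
  proof (induction m)
    case 0
    show ?case using a by (intro exI[of _ "{a}"]) auto
  next
    case (Suc m)
    then obtain I where I: "I \<subseteq> B i" "a \<in> I" "card I = Suc m"
      "\<forall>b\<in>I. X a - X b \<le> 2 * real m * ?c" by auto
    have "I \<noteq> B i" using I(3) Suc.prems by auto
    then have "I \<subset> {a. a < K \<and> \<beta> a = i}" "I \<noteq> {}" using I unfolding B_def by auto
    from block_connected[OF this(2,1)] obtain b b' where
      b: "b \<in> I" "b' \<in> B i - I" "0 < s b (\<pi> b')" unfolding B_def by blast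
    have lt: "b < K" "b' < K" using b I(1) unfolding B_def by auto
    have "X b - X b' \<le> 2 * ?c"
      using pos_entry_upper[OF lt(1) perm_less[OF lt(2)] b(3)] support_pair[OF lt(2)]
        sigma_le_pair_const[OF lt(1)] by linarith
    then have new: "X a - X b' \<le> 2 * real (Suc m) * ?c"
      using I(4) b(1) by (force simp: algebra_simps)
    have old: "X a - X d \<le> 2 * real (Suc m) * ?c" if "d \<in> I" for d
      using I(4) that pair_const_nonneg by (force simp: algebra_simps)
    have "finite I" using I(1) finite_B finite_subset by blast
    then show ?case
      using I b new old by (intro exI[of _ "insert b' I"]) auto
  qed
  have pos: "0 < card (B i)" using a by (metis card_gt_0_iff empty_iff finite_B)
  then obtain m where m: "card (B i) = Suc m" using gr0_implies_Suc by blast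
  obtain I where I: "I \<subseteq> B i" "card I = Suc m" "\<forall>b\<in>I. X a - X b \<le> 2 * real m * ?c"
    using grow[of m] m by auto
  then have "I = B i" using m by (intro card_subset_eq) auto
  then have "X a - X a' \<le> 2 * real m * ?c" using I(3) a' by blast
  also have "\<dots> \<le> 2 * real K * ?c"
    using m card_B[of i] pair_const_nonneg by (intro mult_right_mono) auto
  finally show ?thesis .
qed

lemma block_spread_abs:
  assumes a: "a \<in> B i" and a': "a' \<in> B i"
  shows "\<bar>X a - X a'\<bar> \<le> 2 * real K * pair_const K \<sigma> \<tau>"
  using block_spread[OF a a'] block_spread[OF a' a] by linarith

text \<open>The logarithmic size of a block, read off at an arbitrary entry; by
  \<open>block_spread\<close> the choice matters only up to a bounded error.\<close>

definition x :: "nat \<Rightarrow> real" where "x i = X (SOME a. a \<in> B i)"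

lemma pair_const_le_mult: "a < K \<Longrightarrow> pair_const K \<sigma> \<tau> \<le> real K * pair_const K \<sigma> \<tau>"
  using mult_right_mono[of 1 "real K" "pair_const K \<sigma> \<tau>"] pair_const_nonneg by auto

lemma X_near_x:
  assumes "a \<in> B i"
  shows "\<bar>X a - x i\<bar> \<le> block_const K \<sigma> \<tau>"
proof -
  have "(SOME a. a \<in> B i) \<in> B i" using assms by (rule someI)
  from block_spread_abs[OF assms this] pair_const_nonneg show ?thesis
    unfolding x_def block_const_def by (auto intro: order_trans mult_right_mono)
qed

text \<open>The representative of block \<open>h i\<close> is the image under \<open>\<pi>\<close>
  of some entry of block \<open>i\<close>, so \<open>support_pair\<close> applies after a move
  inside block \<open>i\<close>.\<close>

lemma x_compl:
  assumes i: "i \<in> {1..n}"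
  shows "\<bar>x i + x (h i)\<bar> \<le> block_const K \<sigma> \<tau>"
proof -
  define a b where "a = (SOME a. a \<in> B i)" and "b = (SOME a. a \<in> B (h i))"
  have a: "a \<in> B i" unfolding a_def using B_nonempty[OF i] some_in_eq by blast
  have b: "b \<in> B (h i)" unfolding b_def using B_nonempty[OF compl_range[OF i]] some_in_eq by blast
  then obtain a' where a': "a' \<in> B i" "b = \<pi> a'" using perm_B[OF i] by blast
  have "a' < K" using a' unfolding B_def by auto
  then show ?thesis
    using block_spread_abs[OF a a'(1)] support_pair[OF \<open>a' < K\<close>, folded a'(2)]
      pair_const_le_mult[OF \<open>a' < K\<close>]
    unfolding x_def a_def[symmetric] b_def[symmetric] block_const_def by linarith
qed

text \<open>
  Read the weight of \<open>T\<close> in the block pair \<open>(i, h j)\<close> as a flow from \<open>i\<close> to \<open>j\<close>, with \<open>\<eta> * w\<close> as the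
  flow from \<open>i\<close> to \<open>\<infinity>\<close>. Since all rows and columns of \<open>T\<close>, completed by \<open>\<eta> * w\<close>, sum to 1, what
  leaves \<open>i\<close> equals what enters \<open>i\<close>, and by the symmetry of \<open>T\<close> the latter is what leaves \<open>h i\<close>.
\<close>

definition outflow :: "nat \<Rightarrow> real" where
  "outflow i = (\<Sum>a\<in>B i. \<eta> * w a + (\<Sum>b\<in>{..<K} - B (h i). T a b))"

lemma outflow_eq:
  "outflow i = real (card (B i)) - (\<Sum>a\<in>B i. \<Sum>b\<in>B (h i). T a b)"
proof -
  have "\<eta> * w a + (\<Sum>b\<in>{..<K} - B (h i). T a b) = 1 - (\<Sum>b\<in>B (h i). T a b)" if "a \<in> B i" for a
  proof -
    have "(\<Sum>b<K. T a b) = (\<Sum>b\<in>{..<K} - B (h i). T a b) + (\<Sum>b\<in>B (h i). T a b)"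
      by (intro sum.subset_diff) (auto simp: B_def)
    then show ?thesis using row_sum[of a] that unfolding B_def by auto
  qed
  then show ?thesis unfolding outflow_def by (simp add: sum_subtractf)
qed

lemma outflow_balance:
  assumes i: "i \<in> {1..n}"
  shows "outflow (h i) = outflow i"
proof -
  have "(\<Sum>a\<in>B (h i). \<Sum>b\<in>B i. T a b) = (\<Sum>b\<in>B i. \<Sum>a\<in>B (h i). T a b)"
    by (rule sum.swap)
  also have "\<dots> = (\<Sum>a\<in>B i. \<Sum>b\<in>B (h i). T a b)"
    by (intro sum.cong) (auto simp: B_def T_sym)
  finally show ?thesis
    using compl_compl[OF i] card_B_compl[OF i] by (simp add: outflow_eq)
qed

lemma outflow_ge:
  assumes "a \<in> B i"
  shows "\<eta> * w a \<le> outflow i"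
    and "b < K \<Longrightarrow> \<beta> b \<noteq> h i \<Longrightarrow> T a b \<le> outflow i"
proof -
  have nn: "0 \<le> \<eta> * w c" "0 \<le> (\<Sum>b\<in>{..<K} - B (h i). T c b)" if "c \<in> B i" for c
    using that eta w_pos[of c] T_nonneg[of c] unfolding B_def by (auto intro!: sum_nonneg)
  have le: "\<eta> * w a + (\<Sum>b\<in>{..<K} - B (h i). T a b) \<le> outflow i"
    unfolding outflow_def using assms nn
    by (intro member_le_sum[where f = "\<lambda>a. \<eta> * w a + (\<Sum>b\<in>{..<K} - B (h i). T a b)"])
      (auto intro: add_nonneg_nonneg)
  then show "\<eta> * w a \<le> outflow i" using nn[OF assms] by linarith
  assume "b < K" "\<beta> b \<noteq> h i"
  then have "T a b \<le> (\<Sum>b\<in>{..<K} - B (h i). T a b)"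
    using assms T_nonneg[of a] unfolding B_def by (intro member_le_sum) auto
  then show "T a b \<le> outflow i" using le nn[OF assms] by linarith
qed

text \<open>Up to a factor, a sum of nonnegative terms is its largest term: first the largest row is
  selected, then the larger of its two parts (hence the 2), then the largest term of that
  part.\<close>

lemma outflow_le:
  assumes i: "i \<in> {1..n}"
  shows "(\<exists>a\<in>B i. outflow i \<le> 2 * real K * (\<eta> * w a)) \<or>
    (\<exists>a\<in>B i. \<exists>b<K. \<beta> b \<noteq> h i \<and> 0 < T a b \<and> outflow i \<le> 2 * real K * real K * T a b)"
proof -
  let ?R = "\<lambda>a. \<Sum>b\<in>{..<K} - B (h i). T a b"
  obtain a where a: "a \<in> B i" "outflow i \<le> real (card (B i)) * (\<eta> * w a + ?R a)"
    unfolding outflow_def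
    using sum_le_card_mult_term[OF finite_B B_nonempty[OF i], of "\<lambda>a. \<eta> * w a + ?R a"] by blast
  have aK: "a < K" using a unfolding B_def by auto
  have R0: "0 \<le> ?R a" using T_nonneg[OF aK] by (intro sum_nonneg) auto
  have W0: "0 < \<eta> * w a" using eta w_pos[OF aK] by simp
  have o: "outflow i \<le> real K * (\<eta> * w a + ?R a)"
    using a(2) card_B[of i] R0 W0 by (smt (verit) mult_right_mono of_nat_mono)
  show ?thesis
  proof (cases "?R a \<le> \<eta> * w a")
    case True
    then have "real K * (\<eta> * w a + ?R a) \<le> real K * (2 * (\<eta> * w a))"
      by (intro mult_left_mono) auto
    then show ?thesis using o a(1) by (intro disjI1 bexI[of _ a]) auto
  next
    case False
    then have Rpos: "0 < ?R a" using W0 by linarith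
    \<comment> \<open>A positive sum has a nonempty index set, so a largest term exists.\<close>
    then have "{..<K} - B (h i) \<noteq> {}" by (metis less_irrefl sum.empty)
    then obtain b where b: "b \<in> {..<K} - B (h i)"
      "?R a \<le> real (card ({..<K} - B (h i))) * T a b"
      using sum_le_card_mult_term[of "{..<K} - B (h i)" "T a"] by auto
    have bK: "b < K" "\<beta> b \<noteq> h i" using b(1) unfolding B_def by auto
    have "card ({..<K} - B (h i)) \<le> K"
      using card_mono[of "{..<K}" "{..<K} - B (h i)"] by auto
    then have R: "?R a \<le> real K * T a b"
      using b(2) T_nonneg[OF aK bK(1)] by (smt (verit) mult_right_mono of_nat_mono)
    then have "0 < T a b" using Rpos T_nonneg[OF aK bK(1)] by (cases "T a b = 0") auto
    moreover have "outflow i \<le> 2 * real K * real K * T a b"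
    proof -
      have "real K * (\<eta> * w a + ?R a) \<le> real K * (2 * (real K * T a b))"
        using False R by (intro mult_left_mono) auto
      then show ?thesis using o by (simp add: mult_ac)
    qed
    ultimately show ?thesis using a(1) bK by blast
  qed
qed

section \<open>The min-max system, up to bounded errors\<close>

definition succ_val :: "nat \<Rightarrow> real \<Rightarrow> bool" where
  "succ_val i Y \<longleftrightarrow> Y = - ln \<eta> \<or> (\<exists>j. rel i j \<and> Y = x j)"

definition pred_val :: "nat \<Rightarrow> real \<Rightarrow> bool" where
  "pred_val i Z \<longleftrightarrow> Z = ln \<eta> \<or> (\<exists>j. rel j i \<and> Z = x j)"

text \<open>By \<open>x_compl\<close> the value at block \<open>\<beta> b\<close> is nearly minus
  the value at its complement. This turns the products in \<open>T\<close> into differences along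
  \<open>rel\<close>.\<close>

lemma cross_value:
  assumes "a \<in> B i" "b < K"
  shows "\<bar>X a + X b - (x i - x (h (\<beta> b)))\<bar> \<le> 3 * block_const K \<sigma> \<tau>"
  using X_near_x[OF assms(1)] X_near_x[of b "\<beta> b"] x_compl[OF block_range[OF assms(2)]] assms(2)
  unfolding B_def by auto

lemma const_aux:
  assumes "a < K"
  shows "0 \<le> - ln \<sigma>" "0 \<le> ln \<tau>" "0 \<le> ln (2 * real K)"
    "ln (2 * real K) \<le> ln (2 * real K * real K)"
    "0 \<le> block_const K \<sigma> \<tau>"
  using sigma tau assms block_const_nonneg by (auto intro!: ln_ge_zero)

text \<open>Each flow is one nonnegative part of the total, so every successor value
  \<open>Y\<close> is allowed. In \<open>outflow_upper\<close> only the \<open>Y\<close> of the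
  dominant term is available; together they determine the smallest \<open>Y\<close> up to a bounded
  error.\<close>

lemma outflow_lower:
  assumes i: "i \<in> {1..n}" and Y: "succ_val i Y"
  shows "0 < outflow i" "x i - Y - flow_const K \<sigma> \<tau> \<le> ln (outflow i)"
proof -
  obtain a0 where a0: "a0 \<in> B i" using B_nonempty[OF i] by blast
  have a0K: "a0 < K" using a0 unfolding B_def by auto
  have p0: "0 < \<eta> * w a0" using eta w_pos[OF a0K] by simp
  note c = const_aux[OF a0K]
  show pos: "0 < outflow i" using outflow_ge(1)[OF a0] p0 by linarith
  from Y consider "Y = - ln \<eta>" | j where "rel i j" "Y = x j" unfolding succ_val_def by blast
  then show "x i - Y - flow_const K \<sigma> \<tau> \<le> ln (outflow i)"
  proof cases
    case 1
    have "ln \<eta> + X a0 \<le> ln (outflow i)"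
      using outflow_ge(1)[OF a0] p0 pos eta w_pos[OF a0K] unfolding X_def
      by (metis ln_le_cancel_iff ln_mult_pos)
    then show ?thesis using 1 X_near_x[OF a0] c unfolding flow_const_def by linarith
  next
    case 2
    then obtain a b where ab: "i \<noteq> j" "a < K" "b < K" "\<beta> a = i" "h (\<beta> b) = j" "0 < s a b"
      unfolding rel_def by blast
    have aB: "a \<in> B i" using ab unfolding B_def by auto
    have ne: "\<beta> b \<noteq> h i" using ab compl_compl[OF i] by auto
    have "0 < T a b" using ab w_pos unfolding T_def by simp
    then have "ln (T a b) \<le> ln (outflow i)"
      using outflow_ge(2)[OF aB ab(3) ne] pos by simp
    moreover have "ln \<sigma> \<le> ln (s a b)" using s_lower[OF ab(2,3,6)] sigma by simp
    ultimately show ?thesis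
      using ln_T[OF ab(2,3,6)] cross_value[OF aB ab(3), unfolded ab(5)] 2(2) c unfolding flow_const_def
      by linarith
  qed
qed

lemma outflow_upper:
  assumes i: "i \<in> {1..n}"
  shows "\<exists>Y. succ_val i Y \<and> ln (outflow i) \<le> x i - Y + flow_const K \<sigma> \<tau>"
proof -
  have pos: "0 < outflow i" using outflow_lower(1)[OF i, of "- ln \<eta>"] by (simp add: succ_val_def)
  from outflow_le[OF i] show ?thesis
  proof
    assume "\<exists>a\<in>B i. outflow i \<le> 2 * real K * (\<eta> * w a)"
    then obtain a where a: "a \<in> B i" "outflow i \<le> 2 * real K * (\<eta> * w a)" by blast
    have aK: "a < K" using a unfolding B_def by auto
    have "ln (outflow i) \<le> ln (2 * real K * (\<eta> * w a))"
      using a(2) pos by (intro ln_mono) auto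
    also have "\<dots> = ln (2 * real K) + (ln \<eta> + X a)"
      unfolding X_def using aK eta w_pos[OF aK] by (simp add: ln_mult_pos)
    finally have "ln (outflow i) \<le> x i - (- ln \<eta>) + flow_const K \<sigma> \<tau>"
      using X_near_x[OF a(1)] const_aux[OF aK] unfolding flow_const_def by linarith
    then show ?thesis unfolding succ_val_def by blast
  next
    assume "\<exists>a\<in>B i. \<exists>b<K. \<beta> b \<noteq> h i \<and> 0 < T a b \<and> outflow i \<le> 2 * real K * real K * T a b"
    then obtain a b where a: "a \<in> B i" and b: "b < K" "\<beta> b \<noteq> h i" "0 < T a b"
      "outflow i \<le> 2 * real K * real K * T a b" by blast
    have aK: "a < K" "\<beta> a = i" using a unfolding B_def by auto
    have s: "0 < s a b" using b(3) s_nonneg[OF aK(1) b(1)] unfolding T_def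
      by (metis less_eq_real_def mult_zero_left order_less_irrefl)
    have "ln (outflow i) \<le> ln (2 * real K * real K * T a b)"
      using b(4) pos by (intro ln_mono) auto
    also have "\<dots> = ln (2 * real K * real K) + ln (T a b)"
      using aK b(3) by (subst ln_mult_pos) auto
    finally have 1: "ln (outflow i) \<le> ln (2 * real K * real K) + (ln (s a b) + X a + X b)"
      using ln_T[OF aK(1) b(1) s] by simp
    have "ln (s a b) \<le> ln \<tau>" using s s_upper[OF aK(1) b(1)] by simp
    then have "ln (outflow i) \<le> x i - x (h (\<beta> b)) + flow_const K \<sigma> \<tau>"
      using 1 cross_value[OF a b(1)] const_aux[OF aK(1)] unfolding flow_const_def by linarith
    moreover have "rel i (h (\<beta> b))"
      unfolding rel_def using aK b(1,2) s compl_compl[OF block_range[OF b(1)]] by metis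
    ultimately show ?thesis unfolding succ_val_def by blast
  qed
qed

text \<open>Passing to complements reverses \<open>rel\<close> and nearly negates \<open>x\<close>,
  so successors of \<open>h i\<close> correspond to predecessors of \<open>i\<close> with opposite
  values.\<close>

lemma succ_val_compl:
  assumes i: "i \<in> {1..n}" and V: "succ_val (h i) V"
  shows "\<exists>Z. pred_val i Z \<and> \<bar>Z + V\<bar> \<le> block_const K \<sigma> \<tau>"
proof -
  from V consider "V = - ln \<eta>" | j where "rel (h i) j" "V = x j" unfolding succ_val_def by blast
  then show ?thesis
  proof cases
    case 1 then show ?thesis using block_const_nonneg
      by (intro exI[of _ "ln \<eta>"]) (auto simp: pred_val_def)
  next
    case 2
    have "rel (h j) i" using rel_compl[OF 2(1)] compl_compl[OF i] by simp
    moreover have "\<bar>x (h j) + V\<bar> \<le> block_const K \<sigma> \<tau>"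
      using x_compl[of j] rel_range[OF 2(1)] 2(2) by (simp add: add.commute)
    ultimately show ?thesis unfolding pred_val_def by blast
  qed
qed

lemma pred_val_compl:
  assumes i: "i \<in> {1..n}" and Z: "pred_val i Z"
  shows "\<exists>V. succ_val (h i) V \<and> \<bar>Z + V\<bar> \<le> block_const K \<sigma> \<tau>"
proof -
  from Z consider "Z = ln \<eta>" | j where "rel j i" "Z = x j" unfolding pred_val_def by blast
  then show ?thesis
  proof cases
    case 1 then show ?thesis using block_const_nonneg
      by (intro exI[of _ "- ln \<eta>"]) (auto simp: succ_val_def)
  next
    case 2
    have "rel (h i) (h j)" using rel_compl[OF 2(1)] .
    moreover have "\<bar>Z + x (h j)\<bar> \<le> block_const K \<sigma> \<tau>"
      using x_compl[of j] rel_range[OF 2(1)] 2(2) by simp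
    ultimately show ?thesis unfolding succ_val_def by blast
  qed
qed

text \<open>The common outflow of \<open>i\<close> and \<open>h i\<close> is at least about
  \<open>x i - Y\<close> and at most about \<open>x (h i) - V\<close>, where \<open>x (h i)\<close>
  is close to \<open>- x i\<close> and \<open>V\<close> to \<open>- Z\<close>. With \<open>Y\<close>
  arbitrary and \<open>Z\<close> existential, twice \<open>x i\<close> is at most minimum plus
  maximum; \<open>x_lower\<close> exchanges the quantifiers for the reverse bound.\<close>

lemma x_upper:
  assumes i: "i \<in> {1..n}" and Y: "succ_val i Y"
  shows "\<exists>Z. pred_val i Z \<and> 2 * x i \<le> Y + Z + balance_const K \<sigma> \<tau>"
proof -
  obtain V where V: "succ_val (h i) V" "ln (outflow (h i)) \<le> x (h i) - V + flow_const K \<sigma> \<tau>"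
    using outflow_upper[OF compl_range[OF i]] by blast
  obtain Z where Z: "pred_val i Z" "\<bar>Z + V\<bar> \<le> block_const K \<sigma> \<tau>"
    using succ_val_compl[OF i V(1)] by blast
  have "2 * x i \<le> Y + Z + balance_const K \<sigma> \<tau>"
    using outflow_lower(2)[OF i Y] V(2) Z(2) x_compl[OF i] outflow_balance[OF i]
    unfolding balance_const_def by auto
  then show ?thesis using Z(1) by blast
qed

lemma x_lower:
  assumes i: "i \<in> {1..n}" and Z: "pred_val i Z"
  shows "\<exists>Y. succ_val i Y \<and> Y + Z \<le> 2 * x i + balance_const K \<sigma> \<tau>"
proof -
  obtain V where V: "succ_val (h i) V" "\<bar>Z + V\<bar> \<le> block_const K \<sigma> \<tau>"
    using pred_val_compl[OF i Z] by blast
  obtain Y where Y: "succ_val i Y" "ln (outflow i) \<le> x i - Y + flow_const K \<sigma> \<tau>"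
    using outflow_upper[OF i] by blast
  have "Y + Z \<le> 2 * x i + balance_const K \<sigma> \<tau>"
    using outflow_lower(2)[OF compl_range[OF i] V(1)] V(2) Y(2) x_compl[OF i] outflow_balance[OF i]
    unfolding balance_const_def by auto
  then show ?thesis using Y(1) by blast
qed

section \<open>Comparison with the exact exponents\<close>

lemma n_le_K: "n \<le> K"
proof -
  have "{1..n} \<subseteq> \<beta> ` {..<K}" using block_nonempty by blast
  then have "card {1..n} \<le> card {..<K}" by (rule surj_card_le[OF finite_lessThan])
  then show ?thesis by simp
qed

text \<open>The values \<open>\<phi> i * l\<close> solve the min-max system exactly and
  \<open>x\<close> solves it up to \<open>c\<close>, so the maximum principle applies to both signs
  of the difference. The minimum \<open>p\<close> and maximum \<open>q\<close> are described by
  attainment and bounds, which is how the two arguments use them.\<close>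

theorem exponents:
  fixes \<phi> :: "nat \<Rightarrow> real"
  assumes \<phi>: "\<And>i. i \<in> {1..n} \<Longrightarrow> (h i = i \<and> \<phi> i = 0) \<or>
      (\<exists>p q. 2 * \<phi> i = p + q \<and>
        (p = 1 \<or> (\<exists>j. rel i j \<and> p = \<phi> j)) \<and> p \<le> 1 \<and> (\<forall>j. rel i j \<longrightarrow> p \<le> \<phi> j) \<and>
        (q = -1 \<or> (\<exists>j. rel j i \<and> q = \<phi> j)) \<and> -1 \<le> q \<and> (\<forall>j. rel j i \<longrightarrow> \<phi> j \<le> q))"
    and a: "a < K"
  shows "\<bar>X a - \<phi> (\<beta> a) * (- ln \<eta>)\<bar> \<le> 2 ^ K * balance_const K \<sigma> \<tau> + block_const K \<sigma> \<tau>"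
proof -
  define l where "l = - ln \<eta>"
  define c where "c = balance_const K \<sigma> \<tau>"
  have l0: "0 \<le> l" using eta unfolding l_def by simp
  have bc: "block_const K \<sigma> \<tau> \<le> c" and c0: "0 \<le> c"
    using const_aux[OF a] unfolding c_def balance_const_def flow_const_def by auto
  \<comment> \<open>For a self-complementary block, \<open>x_compl\<close> bounds twice
    \<open>x i\<close>.\<close>
  have fixed: "\<bar>x i - \<phi> i * l\<bar> \<le> c" if "i \<in> {1..n}" "h i = i" "\<phi> i = 0" for i
    using x_compl[OF that(1)] that(2,3) bc c0 by auto
  have up: "x i - \<phi> i * l \<le> 2 ^ n * c" if "i \<in> {1..n}" for i
  proof (rule discrete_max_principle[where I = "{1..n}" and \<rho> = "\<lambda>i. i"
        and \<delta> = "\<lambda>i. x i - \<phi> i * l"])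
    fix i assume i: "i \<in> {1..n}"
    from \<phi>[OF i] consider "h i = i" "\<phi> i = 0"
      | p q where "2 * \<phi> i = p + q" "p = 1 \<or> (\<exists>j. rel i j \<and> p = \<phi> j)"
          "-1 \<le> q" "\<forall>j. rel j i \<longrightarrow> \<phi> j \<le> q" by blast
    then show "x i - \<phi> i * l \<le> c \<or>
      (\<exists>p q. 2 * (x i - \<phi> i * l) \<le> p + q + c \<and> (p \<le> 0 \<or> (\<exists>j\<in>{1..n}. p \<le> x j - \<phi> j * l)) \<and>
             (q \<le> 0 \<or> (\<exists>j\<in>{1..n}. j < i \<and> q \<le> x j - \<phi> j * l)))"
    proof cases
      case 1
      then show ?thesis using fixed[OF i] by auto
    next
      case (2 p q)
      note pq = 2(1) and p = 2(2) and q = 2(3,4)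
      \<comment> \<open>\<open>Y\<close> is taken where \<open>p\<close> is attained, so
        \<open>Y - p * l\<close> is 0 or a difference at a successor. The \<open>Z\<close> that
        \<open>x_upper\<close> then returns is not under control, but \<open>q\<close> dominates
        every candidate.\<close>
      obtain Y where Y: "succ_val i Y" "Y - p * l \<le> 0 \<or> (\<exists>j\<in>{1..n}. Y - p * l \<le> x j - \<phi> j * l)"
      proof (cases "p = 1")
        case True
        then show ?thesis by (intro that[of l]) (auto simp: succ_val_def l_def)
      next
        case False
        then obtain j where "rel i j" "p = \<phi> j" using p by blast
        then show ?thesis using rel_range
          by (intro that[of "x j"]) (auto simp: succ_val_def)
      qed
      obtain Z where Z: "pred_val i Z" "2 * x i \<le> Y + Z + c"
        using x_upper[OF i Y(1)] unfolding c_def by blast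
      have Zq: "Z - q * l \<le> 0 \<or> (\<exists>j\<in>{1..n}. j < i \<and> Z - q * l \<le> x j - \<phi> j * l)"
      proof (cases "Z = ln \<eta>")
        case True
        have "-1 * l \<le> q * l" using q(1) l0 by (rule mult_right_mono)
        then show ?thesis using True unfolding l_def by auto
      next
        case False
        then obtain j where j: "rel j i" "Z = x j" using Z(1) unfolding pred_val_def by blast
        then have "\<phi> j * l \<le> q * l" using q(2) l0 by (simp add: mult_right_mono)
        then show ?thesis using j rel_less rel_range
          by (intro disjI2 bexI[of _ j]) auto
      qed
      have "2 * (x i - \<phi> i * l) = 2 * x i - (2 * \<phi> i) * l" by (simp add: algebra_simps)
      also have "\<dots> = 2 * x i - p * l - q * l" unfolding pq by (simp add: algebra_simps)
      finally have "2 * (x i - \<phi> i * l) \<le> (Y - p * l) + (Z - q * l) + c" using Z(2) by linarith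
      then show ?thesis using Y(2) Zq by blast
    qed
  qed (use that c0 in auto)
  have low: "\<phi> i * l - x i \<le> 2 ^ n * c" if "i \<in> {1..n}" for i
  \<comment> \<open>The uncontrolled value now sits at a successor, so the rank must decrease along
    \<open>rel\<close>; \<open>n + 1 - i\<close> does so and stays between 1 and
    \<open>n\<close>.\<close>
  proof (rule discrete_max_principle[where I = "{1..n}" and \<rho> = "\<lambda>i. n + 1 - i"
        and \<delta> = "\<lambda>i. \<phi> i * l - x i"])
    fix i assume i: "i \<in> {1..n}"
    from \<phi>[OF i] consider "h i = i" "\<phi> i = 0"
      | p q where "2 * \<phi> i = p + q" "q = -1 \<or> (\<exists>j. rel j i \<and> q = \<phi> j)"
          "p \<le> 1" "\<forall>j. rel i j \<longrightarrow> p \<le> \<phi> j" by blast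
    then show "\<phi> i * l - x i \<le> c \<or>
      (\<exists>p q. 2 * (\<phi> i * l - x i) \<le> p + q + c \<and> (p \<le> 0 \<or> (\<exists>j\<in>{1..n}. p \<le> \<phi> j * l - x j)) \<and>
             (q \<le> 0 \<or> (\<exists>j\<in>{1..n}. n + 1 - j < n + 1 - i \<and> q \<le> \<phi> j * l - x j)))"
    proof cases
      case 1
      then show ?thesis using fixed[OF i] by auto
    next
      case (2 p q)
      note pq = 2(1) and q = 2(2) and p = 2(3,4)
      obtain Z where Z: "pred_val i Z" "q * l - Z \<le> 0 \<or> (\<exists>j\<in>{1..n}. q * l - Z \<le> \<phi> j * l - x j)"
      proof (cases "q = -1")
        case True
        then show ?thesis by (intro that[of "- l"]) (auto simp: pred_val_def l_def)
      next
        case False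
        then obtain j where "rel j i" "q = \<phi> j" using q by blast
        then show ?thesis using rel_range
          by (intro that[of "x j"]) (auto simp: pred_val_def)
      qed
      obtain Y where Y: "succ_val i Y" "Y + Z \<le> 2 * x i + c"
        using x_lower[OF i Z(1)] unfolding c_def by blast
      have Yp: "p * l - Y \<le> 0 \<or> (\<exists>j\<in>{1..n}. n + 1 - j < n + 1 - i \<and> p * l - Y \<le> \<phi> j * l - x j)"
      proof (cases "Y = - ln \<eta>")
        case True
        have "p * l \<le> 1 * l" using p(1) l0 by (rule mult_right_mono)
        then show ?thesis using True unfolding l_def by auto
      next
        case False
        then obtain j where j: "rel i j" "Y = x j" using Y(1) unfolding succ_val_def by blast
        then have "p * l \<le> \<phi> j * l" using p(2) l0 by (simp add: mult_right_mono)
        moreover have "n + 1 - j < n + 1 - i" using rel_less[OF j(1)] rel_range[OF j(1)] by auto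
        ultimately show ?thesis using j rel_range
          by (intro disjI2 bexI[of _ j]) auto
      qed
      have "2 * (\<phi> i * l - x i) = (2 * \<phi> i) * l - 2 * x i" by (simp add: algebra_simps)
      also have "\<dots> = q * l + p * l - 2 * x i" unfolding pq by (simp add: algebra_simps)
      finally have "2 * (\<phi> i * l - x i) \<le> (q * l - Z) + (p * l - Y) + c" using Y(2) by linarith
      then show ?thesis using Z(2) Yp by blast
    qed
  qed (use that c0 in auto)
  \<comment> \<open>Passing from \<open>n\<close> to \<open>K\<close> frees the constant from the
    number of blocks.\<close>
  have "(2::real) ^ n * c \<le> 2 ^ K * c"
    using n_le_K c0 by (intro mult_right_mono power_increasing) auto
  moreover have "\<bar>X a - x (\<beta> a)\<bar> \<le> block_const K \<sigma> \<tau>"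
    using X_near_x[of a "\<beta> a"] a unfolding B_def by simp
  ultimately show ?thesis
    using up[OF block_range[OF a]] low[OF block_range[OF a]]
    unfolding l_def[symmetric] c_def[symmetric] by linarith
qed

end

section \<open>Normal forms as block systems\<close>

text \<open>The least index is never 0, because \<open>block_offset k (Suc 0) = 0\<close>; blocks
  therefore count from 1.\<close>

definition block_of :: "(nat \<Rightarrow> nat) \<Rightarrow> nat \<Rightarrow> nat" where
  "block_of k a = (LEAST i. a < block_offset k (Suc i))"

lemma block_offset_Suc: "1 \<le> i \<Longrightarrow> block_offset k (Suc i) = block_offset k i + k i"
  unfolding block_offset_def by simp

lemma block_offset_mono: "i \<le> j \<Longrightarrow> block_offset k i \<le> block_offset k j"
  unfolding block_offset_def by (intro sum_mono2) auto

lemma block_of_offset: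
  assumes "1 \<le> i" "c < k i"
  shows "block_of k (block_offset k i + c) = i"
  unfolding block_of_def
proof (rule Least_equality)
  show "block_offset k i + c < block_offset k (Suc i)"
    using assms by (simp add: block_offset_Suc)
  fix y assume "block_offset k i + c < block_offset k (Suc y)"
  then have "\<not> Suc y \<le> i" using block_offset_mono[of "Suc y" i k] by linarith
  then show "i \<le> y" by simp
qed

lemma offset_decomposition:
  assumes "a < block_offset k (Suc n)"
  shows "\<exists>i\<in>{1..n}. \<exists>c<k i. a = block_offset k i + c"
  using assms
proof (induction n)
  case 0
  then show ?case by (simp add: block_offset_def)
next
  case (Suc n)
  show ?case
  proof (cases "a < block_offset k (Suc n)")
    case True
    then show ?thesis using Suc.IH by fastforce
  next
    case False
    then show ?thesis using Suc.prems block_offset_Suc[of "Suc n" k]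
      by (intro bexI[of _ "Suc n"] exI[of _ "a - block_offset k (Suc n)"]) auto
  qed
qed

lemma sum_lessThan_add:
  fixes g :: "nat \<Rightarrow> 'a::comm_monoid_add"
  shows "sum g {..<m + k} = sum g {..<m} + (\<Sum>c<k. g (m + c))"
  by (induction k) (simp_all add: add.assoc)

lemma sum_blocks:
  fixes g :: "nat \<Rightarrow> 'a::comm_monoid_add"
  shows "(\<Sum>a<block_offset k (Suc n). g a) = (\<Sum>i=1..n. \<Sum>c<k i. g (block_offset k i + c))"
proof (induction n)
  case 0
  then show ?case by (simp add: block_offset_def)
next
  case (Suc n)
  then show ?case by (simp add: block_offset_Suc[of "Suc n"] sum_lessThan_add)
qed

section \<open>Triangular shape of the normal form\<close>

lemma compl_index_range: "i \<in> {1..L + 2 * M} \<Longrightarrow> compl_index L M i \<in> {1..L + 2 * M}"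
  unfolding compl_index_def by auto

lemma compl_index_compl: "i \<in> {1..L + 2 * M} \<Longrightarrow> compl_index L M (compl_index L M i) = i"
  unfolding compl_index_def by auto

text \<open>The zero conditions of \<open>normal_form\<close> cover every position with
  \<open>i\<close> beyond the complement of \<open>j\<close>; the cases place \<open>j\<close> in
  the first, middle or last group of blocks.\<close>

lemma normal_form_triangular:
  assumes nf: "normal_form S L M k" and i: "i \<in> {1..L + 2 * M}" and j: "j \<in> {1..L + 2 * M}"
    and nz: "block S k i j \<noteq> 0\<^sub>m (k i) (k j)"
  shows "i \<le> compl_index L M j"
proof (rule ccontr)
  assume gt: "\<not> i \<le> compl_index L M j"
  have zero: "block S k i j = 0\<^sub>m (k i) (k j)"
    if "(i \<noteq> j \<and> M < i \<and> i \<le> M + L \<and> M < j \<and> j \<le> M + L) \<or>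
      ((M < i \<and> i \<le> M + L \<and> M + L < j) \<or> (M < j \<and> j \<le> M + L \<and> M + L < i) \<or>
         (i > M + L \<and> j > M + L)) \<or>
      (((i \<le> M \<and> j > M + L) \<or> (j \<le> M \<and> i > M + L)) \<and> i + j > L + 2 * M + 1)"
    using nf i j that unfolding normal_form_def by blast
  consider "j \<le> M" | "M < j" "j \<le> M + L" | "M + L < j" by linarith
  then have "block S k i j = 0\<^sub>m (k i) (k j)"
  proof cases
    case 1
    then have "L + 2 * M + 1 - j < i" using gt unfolding compl_index_def by simp
    then have "M + L < i" "i + j > L + 2 * M + 1" using 1 by linarith+
    then show ?thesis using zero 1 by blast
  next
    case 2
    then have "j < i" using gt unfolding compl_index_def by simp
    then have "i \<noteq> j" "M < i" "i \<le> M + L \<or> M + L < i" using 2 by linarith+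
    then show ?thesis using zero 2 by blast
  next
    case 3
    then have "i + j > L + 2 * M + 1" using gt unfolding compl_index_def by simp
    moreover have "i \<le> M \<or> (M < i \<and> i \<le> M + L) \<or> M + L < i" by linarith
    ultimately show ?thesis using zero 3 by blast
  qed
  then show False using nz by simp
qed

lemma block_nonzero_iff:
  "block S k i j \<noteq> 0\<^sub>m (k i) (k j) \<longleftrightarrow>
    (\<exists>c<k i. \<exists>d<k j. S $$ (block_offset k i + c, block_offset k j + d) \<noteq> 0)"
  unfolding block_def by (auto simp: mat_eq_iff)

text \<open>The permutation and the entry bounds are parameters, so they can be chosen from
  \<open>S\<close> before any block structure is given.\<close>

locale normal_form_matrix =
  fixes S :: "real mat" and K L M :: nat and k :: "nat \<Rightarrow> nat" and \<pi> :: "nat \<Rightarrow> nat"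
    and \<sigma> \<tau> :: real
  assumes S: "S \<in> carrier_mat K K" and nf: "normal_form S L M k"
    and perm: "\<pi> permutes {..<K}" and perm_pos: "a < K \<Longrightarrow> 0 < S $$ (a, \<pi> a)"
    and sigma: "0 < \<sigma>" "\<sigma> \<le> 1" and tau: "1 \<le> \<tau>"
    and s_lower: "a < K \<Longrightarrow> b < K \<Longrightarrow> 0 < S $$ (a, b) \<Longrightarrow> \<sigma> \<le> S $$ (a, b)"
    and s_upper: "a < K \<Longrightarrow> b < K \<Longrightarrow> S $$ (a, b) \<le> \<tau>"
begin

abbreviation "n \<equiv> L + 2 * M"
abbreviation "h \<equiv> compl_index L M"
abbreviation "off \<equiv> block_offset k"
abbreviation "\<beta> \<equiv> block_of k"

lemma off_end: "off (Suc n) = K"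
  using nf S unfolding normal_form_def block_offset_def
  by (simp add: atLeastLessThanSuc_atLeastAtMost)

lemma k_facts: "i \<in> {1..n} \<Longrightarrow> 1 \<le> k i \<and> k (h i) = k i"
  using nf unfolding normal_form_def by blast

lemma off_less:
  assumes "i \<in> {1..n}" "c < k i" shows "off i + c < K"
proof -
  have "off i + c < off (Suc i)" using assms by (simp add: block_offset_Suc)
  also have "\<dots> \<le> off (Suc n)" using assms by (intro block_offset_mono) auto
  finally show ?thesis using off_end by simp
qed

lemma \<beta>_off: "i \<in> {1..n} \<Longrightarrow> c < k i \<Longrightarrow> \<beta> (off i + c) = i"
  using block_of_offset by simp

lemma decomp:
  assumes "a < K"
  obtains c where "\<beta> a \<in> {1..n}" "c < k (\<beta> a)" "a = off (\<beta> a) + c"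
proof -
  obtain i c where "i \<in> {1..n}" "c < k i" "a = off i + c"
    using offset_decomposition[of a k n] assms off_end by auto
  then show ?thesis using \<beta>_off that by metis
qed

lemma sum_K: "(\<Sum>a<K. g a) = (\<Sum>i=1..n. \<Sum>c<k i. g (off i + c))"
  for g :: "nat \<Rightarrow> 'a::comm_monoid_add"
  using sum_blocks[of g k n] off_end by simp

lemma S_nonneg: "a < K \<Longrightarrow> b < K \<Longrightarrow> 0 \<le> S $$ (a, b)"
  using nf S unfolding normal_form_def nonneg_mat_def by auto

lemma S_sym: "a < K \<Longrightarrow> b < K \<Longrightarrow> S $$ (a, b) = S $$ (b, a)"
  using nf S unfolding normal_form_def by (metis carrier_matD index_transpose_mat(1))

lemma block_nonzero_pos:
  assumes "i \<in> {1..n}" "j \<in> {1..n}"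
  shows "block S k i j \<noteq> 0\<^sub>m (k i) (k j) \<longleftrightarrow>
    (\<exists>a<K. \<exists>b<K. \<beta> a = i \<and> \<beta> b = j \<and> 0 < S $$ (a, b))"
proof
  assume "block S k i j \<noteq> 0\<^sub>m (k i) (k j)"
  then obtain c d where cd: "c < k i" "d < k j" "S $$ (off i + c, off j + d) \<noteq> 0"
    unfolding block_nonzero_iff by blast
  have lt: "off i + c < K" "off j + d < K" using off_less assms cd by auto
  have "0 < S $$ (off i + c, off j + d)" using S_nonneg[OF lt] cd(3) by simp
  then show "\<exists>a<K. \<exists>b<K. \<beta> a = i \<and> \<beta> b = j \<and> 0 < S $$ (a, b)"
    using lt \<beta>_off[OF assms(1) cd(1)] \<beta>_off[OF assms(2) cd(2)] by blast
next
  assume "\<exists>a<K. \<exists>b<K. \<beta> a = i \<and> \<beta> b = j \<and> 0 < S $$ (a, b)"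
  then obtain a b where ab: "a < K" "b < K" "\<beta> a = i" "\<beta> b = j" "0 < S $$ (a, b)" by blast
  obtain c where c: "c < k i" "a = off i + c" using decomp[OF ab(1)] ab(3) by metis
  obtain d where d: "d < k j" "b = off j + d" using decomp[OF ab(2)] ab(4) by metis
  show "block S k i j \<noteq> 0\<^sub>m (k i) (k j)"
    unfolding block_nonzero_iff using c d ab(5) by (metis less_irrefl)
qed

lemma triangular:
  assumes "a < K" "b < K" "0 < S $$ (a, b)"
  shows "\<beta> a \<le> h (\<beta> b)"
proof -
  have "\<beta> a \<in> {1..n}" "\<beta> b \<in> {1..n}" using decomp assms by metis+
  then show ?thesis
    using normal_form_triangular[OF nf] block_nonzero_pos assms by blast
qed

text \<open>
  By triangularity \<open>\<beta> a \<le> h (\<beta> (\<pi> a))\<close>; both sides have the same sum over \<open>a\<close> because complementary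
  blocks have equal size, so equality holds throughout.
\<close>

lemma perm_block:
  assumes a: "a < K"
  shows "\<beta> (\<pi> a) = h (\<beta> a)"
proof -
  have pK: "\<pi> b < K" if "b < K" for b using permutes_in_image[OF perm] that by auto
  have sumb: "(\<Sum>a<K. g (\<beta> a)) = (\<Sum>i=1..n. k i * g i)" for g :: "nat \<Rightarrow> nat"
    unfolding sum_K by (intro sum.cong) (auto simp: \<beta>_off)
  have "(\<Sum>b<K. h (\<beta> (\<pi> b))) = (\<Sum>b<K. h (\<beta> b))"
    using sum.permute[OF perm, of "\<lambda>b. h (\<beta> b)"] by (simp add: o_def)
  also have "\<dots> = (\<Sum>i=1..n. k i * h i)" by (rule sumb)
  also have "\<dots> = (\<Sum>i=1..n. k i * i)"
    by (rule sum.reindex_bij_witness[of _ h h])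
      (use compl_index_range compl_index_compl k_facts in auto)
  also have "\<dots> = (\<Sum>b<K. \<beta> b)" using sumb[of "\<lambda>i. i"] by simp
  finally have "\<beta> a = h (\<beta> (\<pi> a))"
    using a triangular perm_pos pK
    by (intro sum_mono_inv[of \<beta> "{..<K}" "\<lambda>b. h (\<beta> (\<pi> b))"]) auto
  moreover have "\<beta> (\<pi> a) \<in> {1..n}" using decomp pK[OF a] by metis
  ultimately show ?thesis using compl_index_compl by metis
qed

lemma block_eq_image: "i \<in> {1..n} \<Longrightarrow> {a. a < K \<and> \<beta> a = i} = (+) (off i) ` {..<k i}"
proof (intro subset_antisym subsetI)
  fix a assume "a \<in> {a. a < K \<and> \<beta> a = i}"
  then show "a \<in> (+) (off i) ` {..<k i}" using decomp[of a] by fastforce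
qed (auto simp: off_less \<beta>_off)

lemma card_shift:
  fixes m l :: nat
  assumes "A \<subseteq> (+) m ` {..<l}"
  shows "card {c. c < l \<and> m + c \<in> A} = card A"
proof -
  have "A = (+) m ` {c. c < l \<and> m + c \<in> A}" using assms by auto
  then have "card A = card ((+) m ` {c. c < l \<and> m + c \<in> A})" by (rule arg_cong)
  moreover have "card ((+) m ` {c. c < l \<and> m + c \<in> A}) = card {c. c < l \<and> m + c \<in> A}"
    by (rule card_image) (simp add: inj_on_def)
  ultimately show ?thesis by (rule trans[symmetric])
qed

text \<open>In local coordinates of the block at \<open>(i, h i)\<close>, take the rows
  \<open>I\<close> and as columns the image under \<open>\<pi>\<close> of the rest of the block.
  Their sizes add up to the block dimension, so full indecomposability supplies a nonzero
  entry.\<close>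

lemma block_connected:
  assumes ne: "I \<noteq> {}" and sub: "I \<subset> {a. a < K \<and> \<beta> a = i}"
  shows "\<exists>a\<in>I. \<exists>a'\<in>{a. a < K \<and> \<beta> a = i} - I. 0 < S $$ (a, \<pi> a')"
proof -
  define Bi where "Bi = {a. a < K \<and> \<beta> a = i}"
  have subB: "I \<subset> Bi" using sub unfolding Bi_def .
  have i: "i \<in> {1..n}" using ne sub decomp by blast
  note hi = compl_index_range[OF i]
  have khi: "k (h i) = k i" using k_facts[OF i] by simp
  have Bi: "Bi = (+) (off i) ` {..<k i}" unfolding Bi_def by (rule block_eq_image[OF i])
  have finB: "finite Bi" unfolding Bi by simp
  define I' where "I' = {c. c < k i \<and> off i + c \<in> I}"
  define J' where "J' = {d. d < k i \<and> off (h i) + d \<in> \<pi> ` (Bi - I)}"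
  have "\<pi> ` (Bi - I) \<subseteq> {a. a < K \<and> \<beta> a = h i}"
    using permutes_in_image[OF perm] perm_block unfolding Bi_def by auto
  then have subJ: "\<pi> ` (Bi - I) \<subseteq> (+) (off (h i)) ` {..<k i}"
    using block_eq_image[OF hi] khi by simp
  have cI: "card I' = card I" unfolding I'_def using subB Bi by (intro card_shift) auto
  have "card J' = card (\<pi> ` (Bi - I))" unfolding J'_def using subJ by (rule card_shift)
  also have "\<dots> = card (Bi - I)"
    by (intro card_image inj_on_subset[OF permutes_inj[OF perm]]) simp
  also have "\<dots> = card Bi - card I" using subB finB by (intro card_Diff_subset) (auto intro: finite_subset)
  finally have cJ: "card J' = card Bi - card I" .
  have cB: "card Bi = k i" unfolding Bi by (simp add: card_image)
  have lt: "card I < card Bi" using subB finB by (rule psubset_card_mono[rotated])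
  have I0: "0 < card I" using ne subB finB by (meson card_gt_0_iff finite_subset psubset_imp_subset)
  have "I' \<noteq> {}" "J' \<noteq> {}" using cI I0 cJ lt by auto
  moreover have "I' \<subseteq> {..<k i}" "J' \<subseteq> {..<k i}" unfolding I'_def J'_def by auto
  moreover have "card I' + card J' \<ge> k i" using cI cJ cB lt by simp
  moreover have "fully_indecomposable (block S k i (h i))"
    using nf i unfolding normal_form_def by blast
  moreover have "dim_row (block S k i (h i)) = k i" unfolding block_def by simp
  ultimately obtain c d where cd: "c \<in> I'" "d \<in> J'" "block S k i (h i) $$ (c, d) \<noteq> 0"
    unfolding fully_indecomposable_def by metis
  obtain a' where a': "a' \<in> Bi - I" "\<pi> a' = off (h i) + d" using cd(2) unfolding J'_def by auto
  have c: "c < k i" "off i + c \<in> I" and d: "d < k (h i)"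
    using cd khi unfolding I'_def J'_def by auto
  have "S $$ (off i + c, \<pi> a') \<noteq> 0" using cd(3) c d a'(2) unfolding block_def by simp
  then have "0 < S $$ (off i + c, \<pi> a')"
    using S_nonneg[OF off_less[OF i c(1)] off_less[OF hi d]] a'(2) by simp
  then show ?thesis using c(2) a'(1) unfolding Bi_def by blast
qed

sublocale block_system K n "\<lambda>a b. S $$ (a, b)" \<sigma> \<tau> \<beta> h \<pi>
proof unfold_locales
  fix a assume "a < K" then show "\<beta> a \<in> {1..n}" using decomp by metis
next
  fix i assume i: "i \<in> {1..n}"
  show "\<exists>a<K. \<beta> a = i"
    using off_less[OF i, of 0] \<beta>_off[OF i, of 0] k_facts[OF i]
    by (intro exI[of _ "off i"]) auto
qed (use compl_index_range compl_index_compl S_sym S_nonneg s_lower s_upper sigma tau triangular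
     perm perm_pos perm_block block_connected in auto)

section \<open>The exponent system and the solution in scalar form\<close>

lemma rel_iff: "rel i j \<longleftrightarrow> block_rel S L M k i j"
proof
  assume r: "rel i j"
  then obtain a b where ab: "i \<noteq> j" "a < K" "b < K" "\<beta> a = i" "h (\<beta> b) = j" "0 < S $$ (a, b)"
    unfolding rel_def by blast
  have ij: "i \<in> {1..n}" "j \<in> {1..n}" using rel_range[OF r] by auto
  have "\<beta> b = h j" using ab(5) compl_index_compl block_range[OF ab(3)] by metis
  then have "block S k i (h j) \<noteq> 0\<^sub>m (k i) (k (h j))"
    using block_nonzero_pos[OF ij(1) compl_index_range[OF ij(2)]] ab by blast
  then show "block_rel S L M k i j" unfolding block_rel_def using ij ab(1) by blast
next
  assume "block_rel S L M k i j"
  then have ij: "i \<in> {1..n}" "j \<in> {1..n}" "i \<noteq> j"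
    "block S k i (h j) \<noteq> 0\<^sub>m (k i) (k (h j))" unfolding block_rel_def by auto
  then show "rel i j"
    using block_nonzero_pos[OF ij(1) compl_index_range[OF ij(2)]] compl_index_compl[OF ij(2)]
    unfolding rel_def by metis
qed

text \<open>Brings \<open>Min\<close> and \<open>Max\<close> over extended indices into the form
  required by \<open>exponents\<close>.\<close>

lemma exponent_system_local:
  assumes ex: "exponent_system S L M k f" and i: "i \<in> {1..n}"
  shows "(h i = i \<and> f (enat i) = 0) \<or>
    (\<exists>p q. 2 * f (enat i) = p + q \<and>
        (p = 1 \<or> (\<exists>j. rel i j \<and> p = f (enat j))) \<and> p \<le> 1 \<and> (\<forall>j. rel i j \<longrightarrow> p \<le> f (enat j)) \<and>
        (q = -1 \<or> (\<exists>j. rel j i \<and> q = f (enat j))) \<and> -1 \<le> q \<and> (\<forall>j. rel j i \<longrightarrow> f (enat j) \<le> q))"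
proof (cases "M < i \<and> i \<le> M + L")
  case True
  then show ?thesis using ex unfolding exponent_system_def compl_index_def by auto
next
  case False
  then have iAC: "i \<in> {1..M} \<union> {M + L + 1..L + 2 * M}" using i by auto
  let ?U = "{y \<in> ext_indices L M. ext_rel S L M k (enat i) y}"
  let ?D = "{y \<in> ext_indices L M. ext_rel S L M k y (enat i)}"
  have f0: "f 0 = -1" and f1: "f \<infinity> = 1" using ex unfolding exponent_system_def by auto
  have bound: "-1 \<le> f (enat j) \<and> f (enat j) \<le> 1" if "j \<in> {1..n}" for j
  proof (cases "M < j \<and> j \<le> M + L")
    case True
    then show ?thesis using ex unfolding exponent_system_def by auto
  next
    case False
    then have "j \<in> {1..M} \<union> {M + L + 1..L + 2 * M}" using that by auto
    then have "f (enat j) \<in> {-1<..<1}" using ex unfolding exponent_system_def by blast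
    then show ?thesis by auto
  qed
  have fin: "finite ?U" "finite ?D" unfolding ext_indices_def by auto
  \<comment> \<open>The added element 0 is \<open>enat 0\<close>; block indices start at 1 and so
    never meet it.\<close>
  have i0: "enat i \<noteq> 0" using i by (simp add: zero_enat_def)
  have Umem: "y \<in> ?U \<longleftrightarrow> (\<exists>j. rel i j \<and> y = enat j) \<or> (y = \<infinity> \<and> \<not> (\<exists>j. rel i j))" for y
  proof -
    have "ext_rel S L M k (enat i) y \<longleftrightarrow>
        (\<exists>j. rel i j \<and> y = enat j) \<or> (y = \<infinity> \<and> \<not> (\<exists>j. rel i j))"
      using i i0 rel_range unfolding ext_rel_def rel_iff[symmetric] by auto
    then show ?thesis using rel_range unfolding ext_indices_def by auto
  qed
  have Dmem: "y \<in> ?D \<longleftrightarrow> (\<exists>j. rel j i \<and> y = enat j) \<or> (y = 0 \<and> \<not> (\<exists>j. rel j i))" for y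
  proof -
    have "ext_rel S L M k y (enat i) \<longleftrightarrow>
        (\<exists>j. rel j i \<and> y = enat j) \<or> (y = 0 \<and> \<not> (\<exists>j. rel j i))"
      using i i0 rel_range unfolding ext_rel_def rel_iff[symmetric] by auto
    then show ?thesis using rel_range unfolding ext_indices_def by auto
  qed
  \<comment> \<open>Without a successor \<open>\<infinity>\<close> is a member, and without a
    predecessor 0 is, so minimum and maximum are attained.\<close>
  have "\<exists>y. y \<in> ?U" "\<exists>y. y \<in> ?D" unfolding Umem Dmem by blast+
  then have ne: "?U \<noteq> {}" "?D \<noteq> {}" by blast+
  define p q where "p = Min (f ` ?U)" and "q = Max (f ` ?D)"
  have "f (enat i) = 1 / 2 * (p + q)"
    using ex iAC unfolding exponent_system_def p_def q_def by blast
  then have "2 * f (enat i) = p + q" by simp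
  moreover have "p \<in> f ` ?U" unfolding p_def using fin ne by (intro Min_in) auto
  then have "p = 1 \<or> (\<exists>j. rel i j \<and> p = f (enat j))" using Umem f1 by auto
  moreover from this have "p \<le> 1" using bound rel_range by auto
  moreover have "\<forall>j. rel i j \<longrightarrow> p \<le> f (enat j)"
    unfolding p_def using fin Umem by (intro allI impI Min_le) auto
  moreover have "q \<in> f ` ?D" unfolding q_def using fin ne by (intro Max_in) auto
  then have "q = -1 \<or> (\<exists>j. rel j i \<and> q = f (enat j))" using Dmem f0 by auto
  moreover from this have "-1 \<le> q" using bound rel_range by auto
  moreover have "\<forall>j. rel j i \<longrightarrow> f (enat j) \<le> q"
    unfolding q_def using fin Dmem by (intro allI impI Max_ge) auto
  ultimately show ?thesis by blast
qed

text \<open>Concatenating the blocks of \<open>v\<close> gives one vector \<open>w\<close>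
  satisfying \<open>block_dyson\<close>; the estimate of \<open>exponents\<close> for
  \<open>ln w\<close> is then exponentiated.\<close>

lemma solution_bounds:
  fixes v :: "nat \<Rightarrow> real vec"
  assumes sol: "positive_dyson_solution S L M k \<eta> v" and ex: "exponent_system S L M k f"
    and eta: "0 < \<eta>" "\<eta> \<le> 1" and i: "i \<in> {1..n}" and a: "a < k i"
  defines "D \<equiv> 2 ^ K * balance_const K \<sigma> \<tau> + block_const K \<sigma> \<tau>"
  shows "exp (- D) * \<eta> powr (- f (enat i)) \<le> v i $ a"
    and "v i $ a \<le> exp D * \<eta> powr (- f (enat i))"
proof -
  define w where "w b = v (\<beta> b) $ (b - off (\<beta> b))" for b
  have w_off: "w (off j + c) = v j $ c" if "j \<in> {1..n}" "c < k j" for j c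
    unfolding w_def using \<beta>_off[OF that] by simp
  have pos: "0 < v j $ c"
    and eq: "1 / v j $ c = \<eta> + (\<Sum>l=1..n. (block S k j l *\<^sub>v v l) $ c)"
    if "j \<in> {1..n}" "c < k j" for j c
    using sol that unfolding positive_dyson_solution_def by blast+
  interpret block_dyson K n "\<lambda>a b. S $$ (a, b)" \<sigma> \<tau> \<beta> h \<pi> \<eta> w
  proof unfold_locales
    fix b assume "b < K"
    then obtain c where c: "\<beta> b \<in> {1..n}" "c < k (\<beta> b)" "b = off (\<beta> b) + c" by (rule decomp)
    let ?j = "\<beta> b"
    have wb: "w b = v ?j $ c" using w_off[OF c(1,2)] c(3) by simp
    show "0 < w b" using pos[OF c(1,2)] wb by simp
    have "(block S k ?j l *\<^sub>v v l) $ c = (\<Sum>d<k l. S $$ (b, off l + d) * w (off l + d))"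
      if "l \<in> {1..n}" for l
    proof -
      have "v l \<in> carrier_vec (k l)" using sol that unfolding positive_dyson_solution_def by blast
      then have "(block S k ?j l *\<^sub>v v l) $ c = (\<Sum>d<k l. S $$ (off ?j + c, off l + d) * v l $ d)"
        using c(2) by (auto simp: block_def scalar_prod_def atLeast0LessThan)
      also have "\<dots> = (\<Sum>d<k l. S $$ (b, off l + d) * w (off l + d))"
        using c(3) w_off[OF that] by (intro sum.cong) auto
      finally show ?thesis .
    qed
    then have "(\<Sum>l=1..n. (block S k ?j l *\<^sub>v v l) $ c) = (\<Sum>d<K. S $$ (b, d) * w d)"
      unfolding sum_K by (intro sum.cong) auto
    then show "w b * (\<eta> + (\<Sum>d<K. S $$ (b, d) * w d)) = 1"
      using eq[OF c(1,2)] pos[OF c(1,2)] wb by (simp add: field_simps)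
  qed (use eta in auto)
  have b: "off i + a < K" using off_less[OF i a] .
  have "\<bar>X (off i + a) - f (enat (\<beta> (off i + a))) * (- ln \<eta>)\<bar> \<le> D"
    unfolding D_def by (rule exponents[OF exponent_system_local[OF ex] b])
  then have dist: "\<bar>ln (v i $ a) - f (enat i) * (- ln \<eta>)\<bar> \<le> D"
    unfolding X_def w_off[OF i a] \<beta>_off[OF i a] .
  have v: "v i $ a = exp (ln (v i $ a))" using pos[OF i a] by simp
  have pw: "exp t * \<eta> powr (- f (enat i)) = exp (t + f (enat i) * (- ln \<eta>))" for t
    using eta by (simp add: powr_def mult_exp_exp)
  show "exp (- D) * \<eta> powr (- f (enat i)) \<le> v i $ a"
    unfolding pw by (subst v) (use dist in simp)
  show "v i $ a \<le> exp D * \<eta> powr (- f (enat i))"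
    unfolding pw by (subst v) (use dist in simp)
qed

end

section \<open>Choice of the constant\<close>

lemma entry_bounds:
  fixes S :: "real mat"
  obtains \<sigma> \<tau> where "0 < \<sigma>" "\<sigma> \<le> 1" "1 \<le> \<tau>"
    "\<And>a b. a < K \<Longrightarrow> b < K \<Longrightarrow> 0 < S $$ (a, b) \<Longrightarrow> \<sigma> \<le> S $$ (a, b)"
    "\<And>a b. a < K \<Longrightarrow> b < K \<Longrightarrow> S $$ (a, b) \<le> \<tau>"
proof -
  \<comment> \<open>The extra 1 ensures \<open>\<sigma> \<le> 1 \<le> \<tau>\<close> and keeps the
    set of positive elements nonempty even for \<open>K = 0\<close>.\<close>
  define E where "E = insert 1 ((\<lambda>(a, b). S $$ (a, b)) ` ({..<K} \<times> {..<K}))"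
  have fin: "finite E" and mem: "\<And>a b. a < K \<Longrightarrow> b < K \<Longrightarrow> S $$ (a, b) \<in> E" and one: "1 \<in> E"
    unfolding E_def by auto
  have ne: "{e \<in> E. 0 < e} \<noteq> {}" using one by auto
  have "Min {e \<in> E. 0 < e} \<in> {e \<in> E. 0 < e}" using fin ne by (intro Min_in) auto
  then show thesis
    using fin mem one by (intro that[of "Min {e \<in> E. 0 < e}" "Max E"]) auto
qed

theorem proposition3p2:
  fixes S :: "real mat" and K :: nat
  assumes "S \<in> carrier_mat K K"
    and "transpose_mat S = S"
    and "nonneg_mat S"
    and "has_support S"
  shows "\<exists>C\<ge>1. \<forall>L M k. normal_form S L M k \<longrightarrow>
    (\<forall>(v :: real \<Rightarrow> nat \<Rightarrow> real vec) (f :: enat \<Rightarrow> real).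
       (\<forall>\<eta>>0. positive_dyson_solution S L M k \<eta> (v \<eta>)) \<longrightarrow>
       exponent_system S L M k f \<longrightarrow>
       (\<forall>i\<in>{1..L + 2 * M}. \<forall>a<k i. \<forall>\<eta>\<in>{0<..1}.
          (1 / C) * \<eta> powr (- f (enat i)) \<le> v \<eta> i $ a \<and>
          v \<eta> i $ a \<le> C * \<eta> powr (- f (enat i))))"
proof -
  obtain \<pi> where \<pi>: "\<pi> permutes {..<K}" "\<forall>a<K. 0 < S $$ (a, \<pi> a)"
    using assms(1,4) unfolding has_support_def by auto
  obtain \<sigma> \<tau> where st: "0 < \<sigma>" "\<sigma> \<le> 1" "1 \<le> \<tau>"
    "\<And>a b. a < K \<Longrightarrow> b < K \<Longrightarrow> 0 < S $$ (a, b) \<Longrightarrow> \<sigma> \<le> S $$ (a, b)"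
    "\<And>a b. a < K \<Longrightarrow> b < K \<Longrightarrow> S $$ (a, b) \<le> \<tau>"
    using entry_bounds[of K S] by blast
  define D where "D = 2 ^ K * balance_const K \<sigma> \<tau> + block_const K \<sigma> \<tau>"
  \<comment> \<open>\<open>D\<close> is fixed before \<open>L\<close>, \<open>M\<close> and
    \<open>k\<close>; the maximum gives \<open>C \<ge> 1\<close> without a discussion of the sign of
    \<open>D\<close>.\<close>
  define C where "C = max 1 (exp D)"
  have "(1 / C) * \<eta> powr (- f (enat i)) \<le> v \<eta> i $ a \<and> v \<eta> i $ a \<le> C * \<eta> powr (- f (enat i))"
    if nf: "normal_form S L M k" and v: "\<forall>\<eta>>0. positive_dyson_solution S L M k \<eta> (v \<eta>)"
      and f: "exponent_system S L M k f" and i: "i \<in> {1..L + 2 * M}" and a: "a < k i"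
      and eta: "\<eta> \<in> {0<..1}"
    for L M k i a \<eta> and v :: "real \<Rightarrow> nat \<Rightarrow> real vec" and f :: "enat \<Rightarrow> real"
  proof -
    interpret normal_form_matrix S K L M k \<pi> \<sigma> \<tau>
      using assms(1) nf \<pi> st by unfold_locales auto
    have sol: "positive_dyson_solution S L M k \<eta> (v \<eta>)" using v eta by simp
    have e: "0 < \<eta>" "\<eta> \<le> 1" using eta by auto
    note b = solution_bounds[OF sol f e i a, folded D_def]
    have "1 / C \<le> exp (- D)" unfolding C_def exp_minus inverse_eq_divide
      by (intro divide_left_mono) auto
    then have "(1 / C) * \<eta> powr (- f (enat i)) \<le> exp (- D) * \<eta> powr (- f (enat i))"
      by (intro mult_right_mono) auto
    moreover have "exp D * \<eta> powr (- f (enat i)) \<le> C * \<eta> powr (- f (enat i))"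
      unfolding C_def by (intro mult_right_mono) auto
    ultimately show ?thesis using b by linarith
  qed
  then show ?thesis by (intro exI[of _ C]) (auto simp: C_def)
qed

end
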